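(* Let $E$ be a real Banach space and $F$ a real Hilbert space with a Schauder basis $(b_i)_{i\in\mathbb N}$ that is both Besselian and Hilbertian. Let $U\subset E$ be open, $x_0\in U$, $J_1\subset\mathbb N$, and let $(f_i)_{i\in J_1}:U\to Y(J_1)$ be a $C^1$ mapping. Assume that the Constant Rank Condition Plus (CRC+) holds for $(f_i)_{i\in J_1}$ at $x_0$ with an index set $J_2\subset J_1$ and a neighbourhood $V(x_0)$. Then there exist functions $h_l:Y(J_2)\to\mathbb R$, $l\in J_1\setminus J_2$, of class $C^1$ such that $$f_l(x)=h_l\big((f_i(x))_{i\in J_2}\big)\quad\text{for all } l\in J_1\setminus J_2 \text{ and all } x \text{ in some neighbourhood of } x_0.$$
   Context: Schauder basis of a Banach space $X$: a sequence $(v_i)$ such that every $x\in X$ has a unique expansion $x=\sum_i a_iv_i$ (for finite-dimensional $X$, a linear basis); the biorthogonal functionals $v_i^*\in X^*$ satisfy $v_i^*(v_j)=\delta_{ij}$, $x=\sum_i v_i^*(x)v_i$. A basis $(c_i)$ is Besselian if convergence of $\sum_i\alpha_ic_i$ implies $\sum_i\alpha_i^2<\infty$, and Hilbertian if $\sum_i\alpha_i^2<\infty$ implies convergence of $\sum_i\alpha_ic_i$. It is boundedly-complete if $\sup_N\|\sum_{i\le N}a_iv_i\|<\infty$ implies convergence of $\sum a_iv_i$, and shrinking if $(v_i^* )$ is a basis of $X^*$. $\overline{\operatorname{span}}$ is the norm-closed linear span. For $J=\{j_1<j_2<\dots\}\subset\mathbb N$: $Y(J)=\{(c_i)_{i\in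 J}\mid\sum_{i\in J}c_ib_i\text{ converges in }F\}$ with norm $\sup_N\|\sum_{k=1}^Nc_{j_k}b_{j_k}\|$. CRC+ for $(f_i)_{i\in J_1}$ at $x_0$ with neighbourhood $V(x_0)$ and index set $J_2\subset J_1$ means: 1. $(Df_i(x))_{i\in J_2}$ is a Schauder basis of $\overline{\operatorname{span}}(Df_i(x),\,i\in J_1)\subset E^*$ for all $x\in V(x_0)$; 2. for every $x\in V(x_0)$ there is a (linear) topological isomorphism $z_x:\overline{\operatorname{span}}(Df_i(x),i\in J_2)\to\overline{\operatorname{span}}(Df_i(x_0),i\in J_2)$ with $z_x(Df_i(x))=Df_i(x_0)$, $i\in J_2$; 3. $(Df_i(x_0))_{i\in J_2}(E)=\{(Df_i(x_0)e)_{i\in J_2}\mid e\in E\}$ is closed in $Y(J_2)$; 4. $(Df_i(x_0))_{i\in J_2}$ is a shrinking and boundedly-complete basis of $X_1:=\overline{\operatorname{span}}(Df_i(x_0),i\in J_1)$; 5. $(Df_i(x_0))_{i\in J_2}$ is Besselian for $X_1$; 6. $Df_i(x_0)^*\in E$ for $i\in J_2$, where $Df_i(x_0)^*\in X_1^*$ are the functionals biorthogonal to the basis $(Df_i(x_0))_{i\in J_2}$ of $X_1$; i.e. each $Df_i(x_0)^*$ is evaluation of elements of $X_1\subset E^*$ at an element of $E$. *)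

theory Defs
  imports "HOL-Analysis.Analysis" "HOL-Library.Function_Algebras"
begin

instantiation "fun" :: (type, real_vector) real_vector
begin

definition "scaleR_fun r f = (\<lambda>x. r *\<^sub>R f x)"

instance
  by standard (simp_all add: scaleR_fun_def fun_eq_iff scaleR_add_left scaleR_add_right)

end

section \<open>Normed spaces given by a carrier and a norm\<close>

text \<open>
  The spaces \<open>Y(J)\<close> and the duals of closed subspaces of \<open>E\<^sup>*\<close> depend on terms and hence cannot
  be types.  They are given as a linear subspace of a vector space type together with a norm, of
  which only the values on the subspace matter.
\<close>

record 'a nspace =
  pts :: "'a set"
  nrm :: "'a \<Rightarrow> real"

definition subsp :: "'a::real_normed_vector set \<Rightarrow> 'a nspace" where
  "subsp X = \<lparr>pts = X, nrm = norm\<rparr>"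

abbreviation whole :: "'a::real_normed_vector nspace" where
  "whole \<equiv> subsp UNIV"

definition linear_over :: "'a::real_vector set \<Rightarrow> ('a \<Rightarrow> 'b::real_vector) \<Rightarrow> bool" where
  "linear_over X L \<longleftrightarrow>
     (\<forall>u\<in>X. \<forall>v\<in>X. L (u + v) = L u + L v) \<and> (\<forall>r. \<forall>u\<in>X. L (r *\<^sub>R u) = r *\<^sub>R L u)"

definition bounded_linear_between ::
  "'a::real_vector nspace \<Rightarrow> 'b::real_vector nspace \<Rightarrow> ('a \<Rightarrow> 'b) \<Rightarrow> bool" where
  "bounded_linear_between A B L \<longleftrightarrow>
     linear_over (pts A) L \<and> L ` pts A \<subseteq> pts B \<and>
     (\<exists>K. \<forall>u\<in>pts A. nrm B (L u) \<le> K * nrm A u)"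

definition op_norm :: "'a nspace \<Rightarrow> 'b nspace \<Rightarrow> ('a \<Rightarrow> 'b) \<Rightarrow> real" where
  "op_norm A B L = (SUP u\<in>{u \<in> pts A. nrm A u \<le> 1}. nrm B (L u))"

text \<open>Functionals on \<open>A\<close> are represented by functions that vanish off the carrier.\<close>

definition dual :: "'a::real_vector nspace \<Rightarrow> ('a \<Rightarrow> real) nspace" where
  "dual A = \<lparr>pts = {\<phi>. bounded_linear_between A whole \<phi> \<and> (\<forall>x. x \<notin> pts A \<longrightarrow> \<phi> x = 0)},
             nrm = op_norm A whole\<rparr>"

definition closed_in_nspace :: "'a::real_vector nspace \<Rightarrow> 'a set \<Rightarrow> bool" where
  "closed_in_nspace A S \<longleftrightarrow>
     S \<subseteq> pts A \<and> (\<forall>y\<in>pts A. (\<forall>e>0. \<exists>s\<in>S. nrm A (s - y) < e) \<longrightarrow> y \<in> S)"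

definition has_frechet_derivative_on ::
  "'a::real_vector nspace \<Rightarrow> 'b::real_vector nspace \<Rightarrow> 'a set \<Rightarrow> ('a \<Rightarrow> 'b) \<Rightarrow> ('a \<Rightarrow> 'b) \<Rightarrow> 'a \<Rightarrow> bool"
  where
  "has_frechet_derivative_on A B U f L x \<longleftrightarrow>
     bounded_linear_between A B L \<and>
     (\<forall>e>0. \<exists>d>0. \<forall>y\<in>U. nrm A (y - x) < d \<longrightarrow>
        nrm B (f y - f x - L (y - x)) \<le> e * nrm A (y - x))"

text \<open>To be used for sets \<open>U\<close> that are open in \<open>A\<close>.\<close>

definition C1_on ::
  "'a::real_vector nspace \<Rightarrow> 'b::real_vector nspace \<Rightarrow> 'a set \<Rightarrow> ('a \<Rightarrow> 'b) \<Rightarrow> bool" where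
  "C1_on A B U f \<longleftrightarrow>
     U \<subseteq> pts A \<and> f ` U \<subseteq> pts B \<and>
     (\<exists>D. (\<forall>x\<in>U. has_frechet_derivative_on A B U f (D x) x) \<and>
          (\<forall>x\<in>U. \<forall>e>0. \<exists>d>0. \<forall>y\<in>U. nrm A (y - x) < d \<longrightarrow> op_norm A B (D y - D x) < e))"


section \<open>Schauder bases\<close>

text \<open>
  A family indexed by \<open>J = {j\<^sub>1 < j\<^sub>2 < \<dots>}\<close> is a function on \<open>nat\<close> of which only the values on \<open>J\<close>
  matter; coefficient families are extended by \<open>0\<close> off \<open>J\<close>.  Summing over \<open>J \<inter> {..<N}\<close> for
  \<open>N = 0, 1, 2, \<dots>\<close> runs through exactly the partial sums over \<open>j\<^sub>1, \<dots>, j\<^sub>k\<close> (with repetitions, and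
  with the empty sum), so convergence and suprema are unaffected by this indexing, and finite \<open>J\<close>
  is covered as well.
\<close>

definition ext0 :: "nat set \<Rightarrow> (nat \<Rightarrow> real) \<Rightarrow> nat \<Rightarrow> real" where
  "ext0 J a = (\<lambda>i. if i \<in> J then a i else 0)"

definition psum :: "nat set \<Rightarrow> (nat \<Rightarrow> 'a::real_vector) \<Rightarrow> (nat \<Rightarrow> real) \<Rightarrow> nat \<Rightarrow> 'a" where
  "psum J v a N = (\<Sum>i\<in>J \<inter> {..<N}. a i *\<^sub>R v i)"

definition expansion ::
  "'a::real_vector nspace \<Rightarrow> nat set \<Rightarrow> (nat \<Rightarrow> 'a) \<Rightarrow> (nat \<Rightarrow> real) \<Rightarrow> 'a \<Rightarrow> bool" where
  "expansion A J v a x \<longleftrightarrow> (\<lambda>N. nrm A (psum J v a N - x)) \<longlonglongrightarrow> 0"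

definition series_converges ::
  "'a::real_vector nspace \<Rightarrow> nat set \<Rightarrow> (nat \<Rightarrow> 'a) \<Rightarrow> (nat \<Rightarrow> real) \<Rightarrow> bool" where
  "series_converges A J v a \<longleftrightarrow> (\<exists>x\<in>pts A. expansion A J v a x)"

text \<open>If \<open>J\<close> is finite, this says that the family is a linear basis.\<close>

definition schauder_basis :: "'a::real_vector nspace \<Rightarrow> nat set \<Rightarrow> (nat \<Rightarrow> 'a) \<Rightarrow> bool" where
  "schauder_basis A J v \<longleftrightarrow>
     v ` J \<subseteq> pts A \<and>
     (\<forall>x\<in>pts A. \<exists>!a. (\<forall>i. i \<notin> J \<longrightarrow> a i = 0) \<and> expansion A J v a x)"

definition biorth ::
  "'a::real_vector nspace \<Rightarrow> nat set \<Rightarrow> (nat \<Rightarrow> 'a) \<Rightarrow> nat \<Rightarrow> 'a \<Rightarrow> real" where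
  "biorth A J v i x =
     (if x \<in> pts A then (THE a. (\<forall>i. i \<notin> J \<longrightarrow> a i = 0) \<and> expansion A J v a x) i else 0)"

definition besselian :: "'a::real_vector nspace \<Rightarrow> nat set \<Rightarrow> (nat \<Rightarrow> 'a) \<Rightarrow> bool" where
  "besselian A J v \<longleftrightarrow>
     (\<forall>a. series_converges A J v a \<longrightarrow> (\<lambda>i. (a i)\<^sup>2) summable_on J)"

definition hilbertian :: "'a::real_vector nspace \<Rightarrow> nat set \<Rightarrow> (nat \<Rightarrow> 'a) \<Rightarrow> bool" where
  "hilbertian A J v \<longleftrightarrow>
     (\<forall>a. (\<lambda>i. (a i)\<^sup>2) summable_on J \<longrightarrow> series_converges A J v a)"

definition boundedly_complete :: "'a::real_vector nspace \<Rightarrow> nat set \<Rightarrow> (nat \<Rightarrow> 'a) \<Rightarrow> bool" where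
  "boundedly_complete A J v \<longleftrightarrow>
     (\<forall>a. bdd_above (range (\<lambda>N. nrm A (psum J v a N))) \<longrightarrow> series_converges A J v a)"

definition shrinking :: "'a::real_vector nspace \<Rightarrow> nat set \<Rightarrow> (nat \<Rightarrow> 'a) \<Rightarrow> bool" where
  "shrinking A J v \<longleftrightarrow> schauder_basis (dual A) J (biorth A J v)"


section \<open>The sequence spaces \<open>Y(J)\<close> and the constant rank condition\<close>

definition Y_space :: "(nat \<Rightarrow> 'f::real_normed_vector) \<Rightarrow> nat set \<Rightarrow> (nat \<Rightarrow> real) nspace" where
  "Y_space b J =
     \<lparr>pts = {c. (\<forall>i. i \<notin> J \<longrightarrow> c i = 0) \<and> series_converges whole J b c},
      nrm = (\<lambda>c. SUP N. norm (psum J b c N))\<rparr>"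

text \<open>The derivative of the \<open>i\<close>-th component as an element of the dual space \<open>E\<^sup>*\<close>.\<close>

definition Dcomp ::
  "(nat \<Rightarrow> 'e::real_normed_vector \<Rightarrow> real) \<Rightarrow> 'e \<Rightarrow> nat \<Rightarrow> 'e \<Rightarrow>\<^sub>L real" where
  "Dcomp f x i = Blinfun (frechet_derivative (f i) (at x))"

definition cspan_D ::
  "(nat \<Rightarrow> 'e::real_normed_vector \<Rightarrow> real) \<Rightarrow> nat set \<Rightarrow> 'e \<Rightarrow> ('e \<Rightarrow>\<^sub>L real) set" where
  "cspan_D f J x = closure (span (Dcomp f x ` J))"

definition CRC_plus ::
  "(nat \<Rightarrow> 'f::real_normed_vector) \<Rightarrow> (nat \<Rightarrow> 'e::real_normed_vector \<Rightarrow> real) \<Rightarrow>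
   nat set \<Rightarrow> nat set \<Rightarrow> 'e \<Rightarrow> 'e set \<Rightarrow> bool" where
  "CRC_plus b f J1 J2 x0 V \<longleftrightarrow>
     J2 \<subseteq> J1 \<and>
     (\<forall>x\<in>V. schauder_basis (subsp (cspan_D f J1 x)) J2 (Dcomp f x)) \<and>
     (\<forall>x\<in>V. \<exists>z z'. homeomorphism (cspan_D f J2 x) (cspan_D f J2 x0) z z' \<and>
        linear_over (cspan_D f J2 x) z \<and> (\<forall>i\<in>J2. z (Dcomp f x i) = Dcomp f x0 i)) \<and>
     closed_in_nspace (Y_space b J2) (range (\<lambda>e. ext0 J2 (\<lambda>i. blinfun_apply (Dcomp f x0 i) e))) \<and>
     shrinking (subsp (cspan_D f J1 x0)) J2 (Dcomp f x0) \<and>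
     boundedly_complete (subsp (cspan_D f J1 x0)) J2 (Dcomp f x0) \<and>
     besselian (subsp (cspan_D f J1 x0)) J2 (Dcomp f x0) \<and>
     (\<forall>i\<in>J2. \<exists>e. \<forall>\<xi>\<in>cspan_D f J1 x0.
        biorth (subsp (cspan_D f J1 x0)) J2 (Dcomp f x0) i \<xi> = blinfun_apply \<xi> e)"

end

theory Submission
  imports Defs
begin

text \<open>
  The Besselian and Hilbertian properties make \<open>Y(J)\<close> isomorphic to the square-summable families
  supported on \<open>J\<close>, with constants independent of \<open>J\<close> (\<open>Y_spaces_isomorphic_to_ell2\<close>).  So
  \<open>(f\<^sub>i)\<close> becomes a \<open>C\<^sup>1\<close> map into a Hilbert space, and cutting the coordinates down to \<open>J2\<close> gives a
  \<open>C\<^sup>1\<close> map \<open>g\<close>.  Evaluation of the biorthogonal functionals at elements of \<open>E\<close> puts every unit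
  vector into the range of \<open>Dg(x0)\<close>; as this range is closed, it is all of \<open>Y(J2)\<close>, and \<open>g\<close> is a
  submersion at \<open>x0\<close>.  Since \<open>Df\<^sub>l(x)\<close> is a norm limit of combinations of the \<open>Df\<^sub>i(x)\<close> with
  \<open>i \<in> J2\<close>, it vanishes on the kernel of \<open>Dg(x)\<close> for every \<open>x\<close> near \<open>x0\<close>.

  What remains is a statement about a submersion \<open>g\<close> and a function \<open>\<phi>\<close> whose derivative kills the
  kernel of \<open>Dg(x)\<close>: locally \<open>\<phi> = h \<circ> g\<close> with \<open>h\<close> of class \<open>C\<^sup>1\<close>.  The kernel of \<open>Dg(x0)\<close> need not
  have a closed complement in \<open>E\<close> (a quotient map from \<open>\<ell>\<^sup>1\<close> onto \<open>\<ell>\<^sup>2\<close> is an example), so the implicit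
  function theorem does not provide a chart that straightens the fibres of \<open>g\<close>.  Two points \<open>x\<close>, \<open>y\<close>
  of a fibre are instead connected by a descent argument in the style of Ekeland and Caristi.  From any point \<open>z \<noteq> y\<close> of the fibre one can step to another point \<open>z'\<close> of the fibre that
  is closer to \<open>y\<close> by at least half of the step length (\<open>fibre_step_towards\<close>), and \<open>\<phi>\<close> changes along a
  small step by an arbitrarily small multiple of its length.  The fibre is complete, so
  \<open>descent_principle\<close> leads from \<open>x\<close> to \<open>y\<close> with an arbitrarily small total change of \<open>\<phi>\<close>
  (\<open>constant_on_fibres\<close>).

  Points of the fibres can be chosen with linear control: \<open>g z = c\<close> has a solution \<open>z\<close> within a
  distance of a constant times \<open>\<bar>g a - c\<bar>\<close> from \<open>a\<close> (\<open>metric_regularity\<close>, by Graves).  This makes the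
  function \<open>h\<close> induced by \<open>\<phi>\<close> differentiable, its derivative at \<open>g x\<close> being the factor \<open>\<Lambda> x\<close> in
  \<open>D\<phi>(x) = \<Lambda> x \<circ> Dg(x)\<close>, and makes that derivative continuous.  A cutoff function of the squared
  Hilbert norm extends \<open>h\<close> from a ball to the whole space.
\<close>

section \<open>A descent principle, Baire category and onto maps\<close>

text \<open>Order \<open>M\<close> by \<open>z' \<preceq> z\<close> iff both \<open>z\<close> and its image under \<open>\<psi>\<close> move by at most the decrease of \<open>\<Phi>\<close>.
  A sequence in which every term nearly minimizes \<open>\<Phi>\<close> below its predecessor is Cauchy, since its
  steps are bounded by the decrease of a convergent sequence, and nothing but itself lies below its
  limit.  The step hypothesis then forces \<open>\<Phi> = 0\<close> there.  The function \<open>\<psi>\<close> records a quantity whose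
  total change along the descent has to be controlled.\<close>

lemma descent_principle:
  fixes \<Phi> :: "'a::metric_space \<Rightarrow> real" and \<psi> :: "'a \<Rightarrow> 'b::metric_space"
  assumes M: "complete M" and x: "x \<in> M"
    and cont: "continuous_on M \<Phi>" "continuous_on M \<psi>"
    and nonneg: "\<And>z. z \<in> M \<Longrightarrow> 0 \<le> \<Phi> z"
    and step: "\<And>z. z \<in> M \<Longrightarrow> dist x z \<le> \<Phi> x - \<Phi> z \<Longrightarrow> \<Phi> z \<noteq> 0 \<Longrightarrow>
      \<exists>z'\<in>M. z' \<noteq> z \<and> dist z z' \<le> \<Phi> z - \<Phi> z' \<and> dist (\<psi> z) (\<psi> z') \<le> \<Phi> z - \<Phi> z'"
  obtains z where "z \<in> M" "\<Phi> z = 0" "dist x z \<le> \<Phi> x" "dist (\<psi> x) (\<psi> z) \<le> \<Phi> x"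
proof -
  define S where "S z = {z'\<in>M. dist z z' \<le> \<Phi> z - \<Phi> z' \<and> dist (\<psi> z) (\<psi> z') \<le> \<Phi> z - \<Phi> z'}" for z
  have S_refl: "z \<in> S z" if "z \<in> M" for z
    using that by (simp add: S_def)
  have S_trans: "z'' \<in> S z" if "z' \<in> S z" "z'' \<in> S z'" for z z' z''
    using that dist_triangle[of z z'' z'] dist_triangle[of "\<psi> z" "\<psi> z''" "\<psi> z'"]
    by (auto simp: S_def)
  have S_M: "S z \<subseteq> M" for z by (auto simp: S_def)
  have bdd: "bdd_below (\<Phi> ` S z)" for z
    using nonneg S_M by (intro bdd_belowI[of _ 0]) auto
  have near_inf: "\<exists>z'\<in>S z. \<forall>w\<in>S z. \<Phi> z' \<le> \<Phi> w + e" if "z \<in> M" "e > 0" for z e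
  proof -
    have "Inf (\<Phi> ` S z) < Inf (\<Phi> ` S z) + e" using \<open>e > 0\<close> by simp
    then obtain z' where z': "z' \<in> S z" "\<Phi> z' < Inf (\<Phi> ` S z) + e"
      using S_refl[OF \<open>z \<in> M\<close>] cInf_less_iff[OF _ bdd[of z]] by (metis empty_iff imageE image_is_empty)
    have "\<Phi> z' \<le> \<Phi> w + e" if "w \<in> S z" for w
      using z'(2) cInf_lower[OF imageI[OF that] bdd] by linarith
    then show ?thesis using z'(1) by blast
  qed
  have "\<exists>Z. Z 0 = x \<and> (\<forall>n. Z n \<in> M \<and> Z (Suc n) \<in> S (Z n) \<and>
      (\<forall>w\<in>S (Z n). \<Phi> (Z (Suc n)) \<le> \<Phi> w + (1/2)^n))"
  proof -
    have "\<exists>Z. \<forall>n. (Z n \<in> M \<and> (n = 0 \<longrightarrow> Z n = x)) \<and>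
        (Z (Suc n) \<in> S (Z n) \<and> (\<forall>w\<in>S (Z n). \<Phi> (Z (Suc n)) \<le> \<Phi> w + (1/2)^n))"
    proof (rule dependent_nat_choice)
      show "\<exists>z. z \<in> M \<and> (0 = (0::nat) \<longrightarrow> z = x)" using x by auto
      fix z and n :: nat
      assume "z \<in> M \<and> (n = 0 \<longrightarrow> z = x)"
      then show "\<exists>y. (y \<in> M \<and> (Suc n = 0 \<longrightarrow> y = x)) \<and> y \<in> S z \<and> (\<forall>w\<in>S z. \<Phi> y \<le> \<Phi> w + (1/2)^n)"
        using near_inf[of z "(1/2)^n"] S_M by fastforce
    qed
    then show ?thesis by metis
  qed
  then obtain Z where Z0: "Z 0 = x" and ZM: "\<And>n. Z n \<in> M" and ZS: "\<And>n. Z (Suc n) \<in> S (Z n)"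
    and Zinf: "\<And>n w. w \<in> S (Z n) \<Longrightarrow> \<Phi> (Z (Suc n)) \<le> \<Phi> w + (1/2)^n" by metis
  have Zle: "Z n \<in> S (Z m)" if "m \<le> n" for m n
    using that by (induction rule: dec_induct) (auto intro: S_refl ZM S_trans ZS)
  have "decseq (\<lambda>n. \<Phi> (Z n))"
  proof (rule decseq_SucI)
    show "\<Phi> (Z (Suc n)) \<le> \<Phi> (Z n)" for n
      using ZS[of n] zero_le_dist[of "Z n" "Z (Suc n)"] unfolding S_def mem_Collect_eq by linarith
  qed
  then obtain \<phi> where \<phi>: "(\<lambda>n. \<Phi> (Z n)) \<longlonglongrightarrow> \<phi>"
    using decseq_convergent[of _ 0] nonneg[OF ZM] by metis
  have "Cauchy Z"
  proof (rule metric_CauchyI)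
    fix e :: real assume "e > 0"
    from LIMSEQ_imp_Cauchy[OF \<phi>] this obtain N where
      N: "\<And>m n. m \<ge> N \<Longrightarrow> n \<ge> N \<Longrightarrow> dist (\<Phi> (Z m)) (\<Phi> (Z n)) < e"
      unfolding Cauchy_def by metis
    have "dist (Z m) (Z n) < e" if "m \<ge> N" "n \<ge> N" for m n
    proof (cases "m \<le> n")
      case True
      then show ?thesis using Zle[of m n] N[OF that] by (auto simp: S_def dist_real_def)
    next
      case False
      then show ?thesis using Zle[of n m] N[OF that] by (auto simp: S_def dist_real_def dist_commute)
    qed
    then show "\<exists>N. \<forall>m\<ge>N. \<forall>n\<ge>N. dist (Z m) (Z n) < e" by blast
  qed
  then obtain z where z: "z \<in> M" "Z \<longlonglongrightarrow> z"
    using M ZM unfolding complete_def by metis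
  have "(\<lambda>n. \<Phi> (Z n)) \<longlonglongrightarrow> \<Phi> z" and \<psi>: "(\<lambda>n. \<psi> (Z n)) \<longlonglongrightarrow> \<psi> z"
    using continuous_on_tendsto_compose[OF cont(1) z(2) z(1)]
      continuous_on_tendsto_compose[OF cont(2) z(2) z(1)] ZM by simp_all
  then have \<Phi>: "(\<lambda>n. \<Phi> (Z n)) \<longlonglongrightarrow> \<Phi> z" by simp
  \<comment> \<open>The order is closed, so the limit lies below all terms of the sequence.\<close>
  have zS: "z \<in> S (Z m)" for m
  proof -
    have "dist (Z m) z \<le> \<Phi> (Z m) - \<Phi> z"
      by (rule LIMSEQ_le[OF tendsto_dist[OF tendsto_const z(2)] tendsto_diff[OF tendsto_const \<Phi>]])
        (use Zle[of m] in \<open>auto simp: S_def\<close>)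
    moreover have "dist (\<psi> (Z m)) (\<psi> z) \<le> \<Phi> (Z m) - \<Phi> z"
      by (rule LIMSEQ_le[OF tendsto_dist[OF tendsto_const \<psi>] tendsto_diff[OF tendsto_const \<Phi>]])
        (use Zle[of m] in \<open>auto simp: S_def\<close>)
    ultimately show ?thesis using z(1) by (simp add: S_def)
  qed
  have "\<Phi> z = 0"
  proof (rule ccontr)
    assume "\<Phi> z \<noteq> 0"
    moreover have "dist x z \<le> \<Phi> x - \<Phi> z" using zS[of 0] Z0 by (simp add: S_def)
    ultimately obtain z' where z': "z' \<noteq> z" "z' \<in> S z"
      using step[OF z(1)] by (auto simp: S_def)
    \<comment> \<open>A point below \<open>z\<close> lies below every \<open>Z n\<close>, so near-minimality gives \<open>\<Phi> z \<le> \<Phi> z'\<close>.\<close>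
    have "\<Phi> (Z (Suc n)) \<le> \<Phi> z' + (1/2)^n" for n
      by (rule Zinf) (use S_trans[OF zS z'(2)] in simp)
    moreover have "(\<lambda>n. \<Phi> z' + (1/2)^n) \<longlonglongrightarrow> \<Phi> z' + 0"
      by (intro tendsto_add tendsto_const LIMSEQ_realpow_zero) auto
    ultimately have "\<Phi> z \<le> \<Phi> z' + 0"
      by (intro LIMSEQ_le[OF LIMSEQ_Suc[OF \<Phi>]]) auto
    then show False using z' zero_less_dist_iff[of z z'] unfolding S_def by fastforce
  qed
  with zS[of 0] Z0 z(1) show ?thesis by (intro that[of z]) (auto simp: S_def)
qed

text \<open>The integer multiples of \<open>S\<close> cover the space, so by Baire one of them has interior points; symmetry and convexity move a ball
  from an arbitrary centre to the origin.  This one form of Baire's theorem yields both the open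
  mapping theorem and the uniform bound on partial sums.\<close>

lemma barrel_is_neighbourhood_of_zero:
  fixes S :: "'a::{real_normed_vector, complete_space} set"
  assumes "closed S" "convex S" and sym: "\<And>x. x \<in> S \<Longrightarrow> - x \<in> S"
    and absorbing: "\<And>x. \<exists>r>0. r *\<^sub>R x \<in> S"
  obtains e where "e > 0" "ball 0 e \<subseteq> S"
proof -
  define T where "T n = (\<lambda>x. real (Suc n) *\<^sub>R x) ` S" for n
  have "0 \<in> S" using absorbing[of 0] by simp
  have shrink: "t *\<^sub>R x \<in> S" if "x \<in> S" "0 \<le> t" "t \<le> 1" for x t
    using convexD_alt[OF \<open>convex S\<close> \<open>0 \<in> S\<close> that(1,2,3)] by simp
  have "x \<in> (\<Union>n. T n)" for x
  proof -
    obtain r where r: "r > 0" "r *\<^sub>R x \<in> S" using absorbing by blast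
    obtain n where n: "inverse (real (Suc n)) < r" using reals_Archimedean[OF r(1)] by auto
    have "inverse (real (Suc n)) *\<^sub>R x = (inverse (real (Suc n)) / r) *\<^sub>R (r *\<^sub>R x)"
      using r(1) by simp
    also have "\<dots> \<in> S"
    proof (rule shrink[OF r(2)])
      show "0 \<le> inverse (real (Suc n)) / r" using r(1) by simp
      show "inverse (real (Suc n)) / r \<le> 1"
        unfolding divide_le_eq_1_pos[OF r(1)] using n by linarith
    qed
    finally have "real (Suc n) *\<^sub>R inverse (real (Suc n)) *\<^sub>R x \<in> T n" unfolding T_def by blast
    moreover have "real (Suc n) *\<^sub>R inverse (real (Suc n)) *\<^sub>R x = x" by (simp del: of_nat_Suc)
    ultimately show ?thesis by auto
  qed
  then have union: "(\<Union>n. T n) = UNIV" by blast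
  have closed_T: "closed (T n)" for n
    unfolding T_def using \<open>closed S\<close> by (rule closed_scaling)
  have "\<exists>n. interior (T n) \<noteq> {}"
  proof (rule ccontr)
    assume "\<nexists>n. interior (T n) \<noteq> {}"
    then have "(euclidean :: 'a topology) interior_of \<Union>(range T) = {}"
      using closed_T
      by (intro Baire_category_alt disjI1 completely_metrizable_space_euclidean) auto
    then show False using union by simp
  qed
  then obtain n where n: "interior (T n) \<noteq> {}" ..
  then obtain x e where e: "e > 0" "ball x e \<subseteq> T n" by (auto simp: mem_interior)
  have "u \<in> S" if "u \<in> ball 0 (e / real (Suc n))" for u
  proof -
    have "norm (real (Suc n) *\<^sub>R u) < e"
      using that by (simp add: pos_less_divide_eq mult.commute del: of_nat_Suc)
    then have "x + real (Suc n) *\<^sub>R u \<in> T n" "x - real (Suc n) *\<^sub>R u \<in> T n"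
      by (auto intro!: subsetD[OF e(2)] simp: dist_norm simp del: of_nat_Suc)
    then obtain v w where v: "v \<in> S" "x + real (Suc n) *\<^sub>R u = real (Suc n) *\<^sub>R v"
      and w: "w \<in> S" "x - real (Suc n) *\<^sub>R u = real (Suc n) *\<^sub>R w"
      unfolding T_def by blast
    have "real (Suc n) *\<^sub>R (2 *\<^sub>R u) = real (Suc n) *\<^sub>R (v - w)"
      using arg_cong2[OF v(2) w(2), of "(-)"]
      by (simp add: scaleR_2 scaleR_right_diff_distrib scaleR_right_distrib del: of_nat_Suc)
    then have "2 *\<^sub>R u = v - w"
      by (rule scaleR_left_imp_eq[rotated]) (simp del: of_nat_Suc)
    then have "u = (1/2) *\<^sub>R (v + (- w))" by (metis scaleR_half_double scaleR_2 scaleR_right.add uminus_add_conv_diff add.commute)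
    also have "\<dots> \<in> S"
      using convexD_alt[OF \<open>convex S\<close> v(1) sym[OF w(1)], of "1/2"] by (simp add: scaleR_add_right scaleR_diff_right)
    finally show ?thesis .
  qed
  then have "ball 0 (e / real (Suc n)) \<subseteq> S" by blast
  moreover have "e / real (Suc n) > 0" using e(1) by (simp del: of_nat_Suc)
  ultimately show ?thesis by (rule that[rotated])
qed

text \<open>A residual \<open>g z - c\<close> that can always be halved by a step of length at most \<open>C\<close> times its norm can
  be removed altogether: the lengths sum to a geometric series.  Steps need to exist only at points
  reached so far, which the hypothesis \<open>step\<close> expresses by a bound on the distance from \<open>a\<close> plus the
  length still to be spent; thus the iteration never leaves the ball of radius
  \<open>2 * C * norm (g a - c)\<close>.\<close>

lemma Graves_iteration:
  fixes g :: "'a::banach \<Rightarrow> 'b::real_normed_vector"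
  assumes C: "C > 0" and cont: "continuous_on (cball a (2 * C * norm (g a - c))) g"
    and step: "\<And>z. dist a z + 2 * C * norm (g z - c) \<le> 2 * C * norm (g a - c) \<Longrightarrow>
      \<exists>z'. dist z z' \<le> C * norm (g z - c) \<and> norm (g z' - c) \<le> norm (g z - c) / 2"
  obtains z where "g z = c" "norm (z - a) \<le> 2 * C * norm (g a - c)"
proof -
  define R where "R = 2 * C * norm (g a - c)"
  define \<Phi> where "\<Phi> z = 2 * C * norm (g z - c)" for z
  have "R \<ge> 0" using C by (simp add: R_def)
  have *: "\<exists>z'\<in>cball a R. z' \<noteq> z \<and> dist z z' \<le> \<Phi> z - \<Phi> z' \<and> dist (0::real) 0 \<le> \<Phi> z - \<Phi> z'"
    if z: "z \<in> cball a R" "dist a z \<le> \<Phi> a - \<Phi> z" "\<Phi> z \<noteq> 0" for z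
  proof -
    from z(2) have "dist a z + 2 * C * norm (g z - c) \<le> 2 * C * norm (g a - c)"
      by (simp add: \<Phi>_def)
    from step[OF this] obtain z' where z': "dist z z' \<le> C * norm (g z - c)"
      "norm (g z' - c) \<le> norm (g z - c) / 2" by blast
    have le: "dist z z' \<le> \<Phi> z - \<Phi> z'"
    proof -
      have "2 * C * norm (g z' - c) \<le> 2 * C * (norm (g z - c) / 2)"
        using C z'(2) by (intro mult_left_mono) auto
      then show ?thesis using z'(1) by (simp add: \<Phi>_def)
    qed
    have "norm (g z - c) > 0" using z(3) by (auto simp: \<Phi>_def)
    then have "z' \<noteq> z" using z'(2) by auto
    moreover have "dist a z' \<le> R"
      using dist_triangle[of a z' z] le z(2) C by (simp add: \<Phi>_def R_def) (smt (verit) mult_nonneg_nonneg norm_ge_zero)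
    ultimately show ?thesis using le order_trans[OF zero_le_dist le] by (auto intro!: bexI[of _ z'])
  qed
  have "continuous_on (cball a R) \<Phi>" unfolding \<Phi>_def
    by (intro continuous_intros cont[folded R_def])
  from descent_principle[of "cball a R" a \<Phi> "\<lambda>_. 0::real", OF _ _ this _ _ *] obtain z
    where "\<Phi> z = 0" "dist a z \<le> \<Phi> a"
    using \<open>R \<ge> 0\<close> C by (auto simp: complete_eq_closed \<Phi>_def)
  then show ?thesis using C that[of z] by (simp add: \<Phi>_def dist_norm norm_minus_commute)
qed

lemma approximately_onto_imp_onto:
  fixes A :: "'a::banach \<Rightarrow>\<^sub>L 'b::real_normed_vector"
  assumes C: "C > 0"
    and approx: "\<And>y. \<exists>u. norm u \<le> C * norm y \<and> norm (A u - y) \<le> norm y / 2"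
  obtains u where "A u = y" "norm u \<le> 2 * C * norm y"
proof (rule Graves_iteration[of C 0 A y])
  show "continuous_on (cball 0 (2 * C * norm (blinfun_apply A 0 - y))) (blinfun_apply A)"
    by (intro continuous_intros)
  fix z
  from approx[of "y - A z"] obtain u where u: "norm u \<le> C * norm (y - A z)"
    "norm (A u - (y - A z)) \<le> norm (y - A z) / 2" by blast
  then show "\<exists>z'. dist z z' \<le> C * norm (A z - y) \<and> norm (A z' - y) \<le> norm (A z - y) / 2"
    by (intro exI[of _ "z + u"]) (simp add: dist_norm norm_minus_commute blinfun.add_right algebra_simps)
qed (use C that in auto)

text \<open>The constant makes being onto stable under small perturbations of the operator.\<close>

definition onto_with_constant :: "real \<Rightarrow> ('a::real_normed_vector \<Rightarrow>\<^sub>L 'b::real_normed_vector) \<Rightarrow> bool" where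
  "onto_with_constant C A \<longleftrightarrow> C > 0 \<and> (\<forall>y. \<exists>u. A u = y \<and> norm u \<le> C * norm y)"

text \<open>The closure of the image of the unit ball is a barrel in the target, so every \<open>y\<close> is hit up to half
  of its norm by a vector of controlled norm; iteration turns this into an exact solution.\<close>

lemma open_mapping:
  fixes A :: "'a::banach \<Rightarrow>\<^sub>L 'b::{real_normed_vector, complete_space}"
  assumes "surj (blinfun_apply A)"
  obtains C where "onto_with_constant C A"
proof -
  define S where "S = closure (A ` cball 0 1)"
  have lin: "linear (blinfun_apply A)" by (intro bounded_linear.linear blinfun.bounded_linear_right)
  have "\<exists>r>0. r *\<^sub>R y \<in> S" for y
  proof -
    obtain u where u: "y = A u" using assms by (metis surjD)
    have "inverse (norm u + 1) *\<^sub>R y = A (inverse (norm u + 1) *\<^sub>R u)"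
      by (simp add: u blinfun.scaleR_right)
    moreover have "inverse (norm u + 1) *\<^sub>R u \<in> cball 0 1"
      by (simp add: field_simps add_pos_nonneg abs_of_nonneg)
    ultimately have "inverse (norm u + 1) *\<^sub>R y \<in> S"
      unfolding S_def by (metis closure_subset imageI subsetD)
    then show ?thesis by (intro exI[of _ "inverse (norm u + 1)"]) (simp add: add_nonneg_pos)
  qed
  moreover have neg: "- y \<in> S" if "y \<in> S" for y
  proof -
    have "uminus ` (A ` cball 0 1) = A ` cball 0 1"
      by (auto simp: image_image simp flip: blinfun.minus_right intro!: image_eqI[where x = "- _"])
    moreover have "uminus ` S = closure (uminus ` (A ` cball 0 1))"
      using closure_scaleR[of "-1" "A ` cball 0 1"] unfolding S_def scaleR_minus1_left .
    ultimately have "uminus ` S = S" by (simp add: S_def)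
    then show ?thesis using that by blast
  qed
  moreover have "closed S" by (simp add: S_def)
  moreover have "convex S" unfolding S_def
    by (intro convex_closure convex_linear_image lin convex_cball)
  ultimately obtain e where e: "e > 0" "ball 0 e \<subseteq> S"
    using barrel_is_neighbourhood_of_zero[of S] by blast
  have "\<exists>u. norm u \<le> (2/e) * norm y \<and> norm (A u - y) \<le> norm y / 2" for y
  proof (cases "y = 0")
    case True then show ?thesis by (intro exI[of _ 0]) simp
  next
    case False
    define s where "s = e / (2 * norm y)"
    have s: "s > 0" "s * norm y = e/2" using e(1) False by (simp_all add: s_def)
    have "s *\<^sub>R y \<in> S" using s e by (intro subsetD[OF e(2)]) simp
    then obtain w where w: "norm w \<le> 1" "dist (A w) (s *\<^sub>R y) < e/4"
      using e(1) unfolding S_def closure_approachable by (metis (no_types, lifting) zero_less_divide_iff zero_less_numeral imageE mem_cball_0)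
    have "A (inverse s *\<^sub>R w) - y = inverse s *\<^sub>R (A w - s *\<^sub>R y)"
      using s(1) by (simp add: blinfun.scaleR_right scaleR_diff_right)
    then have "norm (A (inverse s *\<^sub>R w) - y) = inverse s * norm (A w - s *\<^sub>R y)"
      using s(1) by simp
    also have "\<dots> \<le> inverse s * (e/4)"
      using w(2) s(1) by (intro mult_left_mono) (auto simp: dist_norm)
    also have "\<dots> = norm y / 2" using s e(1) by (simp add: s_def)
    finally have 1: "norm (A (inverse s *\<^sub>R w) - y) \<le> norm y / 2" .
    have "norm (inverse s *\<^sub>R w) \<le> inverse s * 1"
      using w(1) s(1) by (simp add: mult_left_mono)
    also have "\<dots> = (2/e) * norm y" using e(1) by (simp add: s_def)
    finally show ?thesis using 1 by blast
  qed
  from approximately_onto_imp_onto[OF _ this] e(1)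
  have "\<exists>u. A u = y \<and> norm u \<le> 2 * (2/e) * norm y" for y
    by (metis zero_less_divide_iff zero_less_numeral)
  then show ?thesis using e(1) by (intro that[of "2 * (2/e)"]) (auto simp: onto_with_constant_def)
qed

text \<open>A short solution of \<open>G u = y\<close> solves \<open>A u = y\<close> up to half of the norm of \<open>y\<close>.\<close>

lemma onto_with_constant_perturb:
  fixes G A :: "'a::banach \<Rightarrow>\<^sub>L 'b::real_normed_vector"
  assumes G: "onto_with_constant C G" and near: "2 * C * norm (A - G) \<le> 1"
  shows "onto_with_constant (2 * C) A"
proof -
  have C: "C > 0" using G by (simp add: onto_with_constant_def)
  have "\<exists>u. norm u \<le> C * norm y \<and> norm (A u - y) \<le> norm y / 2" for y
  proof -
    obtain u where u: "G u = y" "norm u \<le> C * norm y"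
      using G by (auto simp: onto_with_constant_def)
    have "norm (A u - y) = norm ((A - G) u)" by (simp add: u blinfun.diff_left)
    also have "\<dots> \<le> norm (A - G) * norm u" by (rule norm_blinfun)
    also have "\<dots> \<le> norm (A - G) * (C * norm y)" using u by (intro mult_left_mono) auto
    also have "\<dots> = (2 * C * norm (A - G)) * (norm y / 2)" by simp
    also have "\<dots> \<le> 1 * (norm y / 2)" using near by (intro mult_right_mono) auto
    finally show ?thesis using u by auto
  qed
  from approximately_onto_imp_onto[OF C this] C show ?thesis
    by (simp add: onto_with_constant_def) metis
qed

section \<open>Functions that depend on a submersion\<close>

text \<open>The linear map \<open>L\<close> with \<open>L \<circ> A = B\<close>, for \<open>A\<close> onto and \<open>B\<close> vanishing on the kernel of \<open>A\<close>.\<close>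

definition factor_through ::
  "('a::real_normed_vector \<Rightarrow>\<^sub>L 'b::real_normed_vector) \<Rightarrow> ('a \<Rightarrow>\<^sub>L real) \<Rightarrow> 'b \<Rightarrow>\<^sub>L real" where
  "factor_through A B = Blinfun (\<lambda>y. B (SOME u. A u = y))"

lemma factor_through_apply:
  assumes A: "onto_with_constant C A" and ker: "\<And>u. A u = 0 \<Longrightarrow> blinfun_apply B u = 0"
  shows "factor_through A B (A u) = B u"
proof -
  let ?f = "\<lambda>y. B (SOME u. A u = y)"
  have f: "?f (A u) = B u" for u
  proof -
    have "A (SOME v. A v = A u) = A u" by (rule someI) simp
    then have "A ((SOME v. A v = A u) - u) = 0" by (simp add: blinfun.diff_right)
    from ker[OF this] show ?thesis by (simp add: blinfun.diff_right)
  qed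
  have pre: "\<exists>u. A u = y \<and> norm u \<le> C * norm y" for y
    using A by (simp add: onto_with_constant_def)
  have bd: "norm (?f y) \<le> norm y * (C * norm B)" for y
  proof -
    obtain u where u: "A u = y" "norm u \<le> C * norm y" using pre by blast
    have "norm (B u) \<le> norm B * norm u" by (rule norm_blinfun)
    also have "\<dots> \<le> norm B * (C * norm y)" using u by (intro mult_left_mono) auto
    finally show ?thesis using f[of u] u by (simp add: mult_ac)
  qed
  have bl: "bounded_linear ?f"
  proof (rule bounded_linear_intro[OF _ _ bd])
    fix y z r
    obtain u v where "y = A u" "z = A v" using pre by metis
    then show "?f (y + z) = ?f y + ?f z" "?f (r *\<^sub>R y) = r *\<^sub>R ?f y"
      using f[of "u + v"] f[of "r *\<^sub>R u"] f[of u] f[of v]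
      by (simp_all add: blinfun.add_right blinfun.scaleR_right)
  qed
  then show "factor_through A B (A u) = B u"
    by (simp add: factor_through_def bounded_linear_Blinfun_apply f)
qed

text \<open>
  A map whose derivative is onto with a uniform constant \<open>C\<close> on a ball and oscillates there by at
  most \<open>1 / (8 * C)\<close>.  The factor 8 leaves room for two losses: a Newton step halves the residual
  (in fact divides it by 8), and a chord between two points of a fibre is tangent to the fibre up to
  an eighth of its length.
\<close>

locale near_submersion =
  fixes g :: "'a::banach \<Rightarrow> 'b::real_normed_vector" and g' :: "'a \<Rightarrow> 'a \<Rightarrow>\<^sub>L 'b"
    and x0 :: 'a and \<rho> C :: real
  assumes \<rho>: "\<rho> > 0"
    and deriv: "\<And>x. x \<in> ball x0 \<rho> \<Longrightarrow> (g has_derivative g' x) (at x)"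
    and onto: "\<And>x. x \<in> ball x0 \<rho> \<Longrightarrow> onto_with_constant C (g' x)"
    and near: "\<And>x y. x \<in> ball x0 \<rho> \<Longrightarrow> y \<in> ball x0 \<rho> \<Longrightarrow> 8 * C * norm (g' x - g' y) \<le> 1"
begin

lemma C: "C > 0"
  using onto[of x0] \<rho> by (simp add: onto_with_constant_def)

lemma continuous_on_g: "continuous_on (ball x0 \<rho>) g"
  by (rule has_derivative_continuous_on) (use deriv in \<open>auto intro: has_derivative_at_withinI\<close>)

lemma linearization:
  assumes "z \<in> ball x0 \<rho>" "w \<in> ball x0 \<rho>"
  shows "8 * C * norm (g w - g z - g' z (w - z)) \<le> norm (w - z)"
proof -
  have "norm (g w - g z - g' z (w - z)) \<le> norm (w - z) * (1 / (8 * C))"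
  proof (rule differentiable_bound_linearization)
    show "z + t *\<^sub>R (w - z) \<in> ball x0 \<rho>" if "t \<in> {0..1}" for t
      using convexD_alt[OF convex_ball assms, of t] that by (simp add: algebra_simps)
    show "(g has_derivative g' x) (at x within ball x0 \<rho>)" if "x \<in> ball x0 \<rho>" for x
      using deriv[OF that] by (rule has_derivative_at_withinI)
    show "onorm (blinfun_apply (g' x) - blinfun_apply (g' z)) \<le> 1 / (8 * C)" if "x \<in> ball x0 \<rho>" for x
      using near[OF that assms(1)] C
      by (simp add: field_simps fun_diff_def norm_blinfun.rep_eq minus_blinfun.rep_eq)
  qed (fact assms)
  then show ?thesis using C by (simp add: field_simps)
qed

text \<open>Newton's iteration: at the point \<open>z\<close> reached, step by a short solution \<open>u\<close> of \<open>g' z u = c - g z\<close>.  The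
  oscillation bound on the derivative makes the new residual at most an eighth of the old one.\<close>

lemma metric_regularity:
  assumes a: "dist x0 a + 2 * C * norm (g a - c) < \<rho>"
  obtains z where "g z = c" "norm (z - a) \<le> 2 * C * norm (g a - c)"
proof (rule Graves_iteration[OF C, of a g c])
  have "cball a (2 * C * norm (g a - c)) \<subseteq> ball x0 \<rho>"
  proof
    fix z assume "z \<in> cball a (2 * C * norm (g a - c))"
    then show "z \<in> ball x0 \<rho>" using a dist_triangle[of x0 z a] by simp
  qed
  then show "continuous_on (cball a (2 * C * norm (g a - c))) g"
    using continuous_on_g continuous_on_subset by blast
  fix z assume z: "dist a z + 2 * C * norm (g z - c) \<le> 2 * C * norm (g a - c)"
  have pos: "0 \<le> C * norm (g z - c)" using C by simp
  have z_ball: "z \<in> ball x0 \<rho>"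
    using dist_triangle[of x0 z a] z a pos by simp
  obtain u where u: "g' z u = c - g z" "norm u \<le> C * norm (g z - c)"
    using onto[OF z_ball] unfolding onto_with_constant_def by (metis norm_minus_commute)
  have "dist x0 (z + u) \<le> dist x0 a + dist a z + norm u"
    using dist_triangle[of x0 "z + u" z] dist_triangle[of x0 z a] by (simp add: dist_norm)
  then have zu: "z + u \<in> ball x0 \<rho>" using a z u pos by simp
  have "C * norm (g (z + u) - c) * 8 \<le> norm u"
    using linearization[OF z_ball zu] u(1) by (simp add: mult_ac)
  also have "\<dots> \<le> C * norm (g z - c)" by fact
  finally have "C * (norm (g (z + u) - c) * 8) \<le> C * norm (g z - c)" by simp
  then have "norm (g (z + u) - c) * 8 \<le> norm (g z - c)" using C by simp
  then have "norm (g (z + u) - c) \<le> norm (g z - c) / 2"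
    using norm_ge_zero[of "g (z + u) - c"] by linarith
  then show "\<exists>z'. dist z z' \<le> C * norm (g z - c) \<and> norm (g z' - c) \<le> norm (g z - c) / 2"
    using u(2) by (intro exI[of _ "z + u"]) (simp add: dist_norm)
qed (use that in auto)

text \<open>The chord from \<open>z\<close> to \<open>y\<close> is almost tangent to the fibre: since \<open>g z = g y\<close>, its image under
  \<open>g' z\<close> is at most \<open>d / (8 * C)\<close> where \<open>d\<close> is its length, and a correction \<open>w\<close> of norm at most
  \<open>d / 8\<close> brings it into the kernel.  A short step along the corrected chord leaves the fibre only to
  higher order, and metric regularity returns to the fibre.  In total the distance to \<open>y\<close> drops by at
  least \<open>3 / 4 * t * d\<close>, while the step has length at most \<open>5 / 4 * t * d\<close>.\<close>

lemma fibre_step_towards: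
  assumes z: "z \<in> ball x0 (3 / 4 * \<rho>)" and y: "y \<in> ball x0 \<rho>" and "g z = g y" "z \<noteq> y" and "\<epsilon> > 0"
  obtains z' where "g z' = g y" "norm (z' - y) + norm (z' - z) / 2 \<le> norm (z - y)"
    "z' \<noteq> z" "norm (z' - z) < \<epsilon>"
proof -
  define d where "d = norm (z - y)"
  have d: "d > 0" using \<open>z \<noteq> y\<close> by (simp add: d_def)
  have z_ball: "z \<in> ball x0 \<rho>" using z \<rho> by simp
  obtain w where w: "g' z w = g' z (y - z)" "norm w \<le> C * norm (g' z (y - z))"
    using onto[OF z_ball] by (auto simp: onto_with_constant_def)
  have "8 * (C * norm (g' z (y - z))) \<le> d"
    using linearization[OF z_ball y] \<open>g z = g y\<close> by (simp add: d_def norm_minus_commute mult_ac)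
  with w have w8: "norm w \<le> d / 8" by simp
  define v where "v = y - z - w"
  have v0: "g' z v = 0" by (simp add: v_def blinfun.diff_right w(1))
  have v: "norm v \<le> 9 / 8 * d"
    using norm_triangle_ineq4[of "y - z" w] w8 by (simp add: v_def d_def norm_minus_commute)
  \<comment> \<open>Metric regularity multiplies the error by \<open>2 * C\<close>, which leaves a sixteenth of the step.\<close>
  obtain \<delta> where \<delta>: "\<delta> > 0" "\<And>p. norm (p - z) < \<delta> \<Longrightarrow>
      norm (g p - g z - g' z (p - z)) \<le> 1 / (32 * C) * norm (p - z)"
    using deriv[OF z_ball] C unfolding has_derivative_at_alt
    by (metis (no_types, opaque_lifting) mult_pos_pos zero_less_divide_1_iff zero_less_numeral)
  \<comment> \<open>The step has to stay where the linearization at \<open>z\<close> is accurate, to be shorter than \<open>\<epsilon>\<close>, and to remain in the ball.\<close>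
  define m where "m = min (min \<delta> \<epsilon>) (\<rho> / 4)"
  have m: "m > 0" "m \<le> \<delta>" "m \<le> \<epsilon>" "m \<le> \<rho> / 4"
    using \<delta>(1) \<open>\<epsilon> > 0\<close> \<rho> by (auto simp: m_def)
  define t where "t = min 1 (m / (2 * d))"
  have t: "0 < t" "t \<le> 1" using m d by (auto simp: t_def)
  have "t \<le> m / (2 * d)" by (simp add: t_def)
  then have td: "2 * (t * d) \<le> m" using d by (simp add: field_simps)
  have td0: "t * d > 0" using t d by simp
  define p where "p = z + t *\<^sub>R v"
  have pz: "norm (p - z) \<le> 9 / 8 * (t * d)"
    using mult_left_mono[OF v, of t] t by (simp add: p_def mult_ac)
  then have "norm (p - z) < \<delta>" using td td0 m by linarith
  from \<delta>(2)[OF this] have "norm (g p - g y) \<le> 1 / (32 * C) * norm (p - z)"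
    using v0 \<open>g z = g y\<close> by (simp add: p_def blinfun.scaleR_right)
  then have "2 * C * norm (g p - g y) \<le> norm (p - z) / 16"
    using C by (simp add: field_simps)
  with pz have gp: "2 * C * norm (g p - g y) \<le> t * d / 8" using td0 by simp
  have "dist x0 p \<le> dist x0 z + norm (p - z)"
    using dist_triangle[of x0 p z] by (simp add: dist_norm norm_minus_commute)
  then have "dist x0 p + 2 * C * norm (g p - g y) < \<rho>"
    using gp pz z td td0 m by simp
  from metric_regularity[OF this] obtain z' where
    z': "g z' = g y" "norm (z' - p) \<le> 2 * C * norm (g p - g y)" by blast
  have z'p: "norm (z' - p) \<le> t * d / 8" using z' gp by linarith
  have "z' - z = (z' - p) + (p - z)" by simp
  then have z'z: "norm (z' - z) \<le> 5 / 4 * (t * d)"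
    using norm_triangle_ineq[of "z' - p" "p - z"] z'p pz by simp
  have "z' - y = (1 - t) *\<^sub>R (z - y) + ((z' - p) - t *\<^sub>R w)"
    by (simp add: p_def v_def algebra_simps)
  then have "norm (z' - y) \<le> norm ((1 - t) *\<^sub>R (z - y)) + (norm (z' - p) + norm (t *\<^sub>R w))"
    by (metis norm_triangle_ineq4 norm_triangle_le add_left_mono)
  also have "norm ((1 - t) *\<^sub>R (z - y)) = d - t * d"
    unfolding norm_scaleR using t by (simp add: d_def left_diff_distrib)
  also have "norm (t *\<^sub>R w) \<le> t * d / 8"
    using mult_left_mono[OF w8, of t] t by simp
  finally have z'y: "norm (z' - y) \<le> d - 3 / 4 * (t * d)" using z'p by linarith
  show ?thesis
  proof (rule that[OF z'(1)])
    show "norm (z' - y) + norm (z' - z) / 2 \<le> norm (z - y)"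
      using z'y z'z td0 by (simp add: d_def)
    show "z' \<noteq> z" using z'y td0 by (auto simp: d_def)
    show "norm (z' - z) < \<epsilon>" using z'z td td0 m by linarith
  qed
qed

end

locale near_submersion_dependent = near_submersion g g' x0 \<rho> C
  for g :: "'a::banach \<Rightarrow> 'b::real_normed_vector" and g' x0 \<rho> C +
  fixes \<phi> :: "'a \<Rightarrow> real" and \<phi>' :: "'a \<Rightarrow> 'a \<Rightarrow>\<^sub>L real"
  assumes \<phi>_deriv: "\<And>x. x \<in> ball x0 \<rho> \<Longrightarrow> (\<phi> has_derivative \<phi>' x) (at x)"
    and ker: "\<And>x u. x \<in> ball x0 \<rho> \<Longrightarrow> g' x u = 0 \<Longrightarrow> \<phi>' x u = 0"
begin

lemma continuous_on_\<phi>: "continuous_on (ball x0 \<rho>) \<phi>"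
  by (rule has_derivative_continuous_on) (use \<phi>_deriv in \<open>auto intro: has_derivative_at_withinI\<close>)

definition \<Lambda> :: "'a \<Rightarrow> 'b \<Rightarrow>\<^sub>L real" where
  "\<Lambda> x = factor_through (g' x) (\<phi>' x)"

lemma \<Lambda>_apply: "x \<in> ball x0 \<rho> \<Longrightarrow> \<Lambda> x (g' x u) = \<phi>' x u"
  unfolding \<Lambda>_def by (rule factor_through_apply[OF onto ker])

text \<open>The function \<open>\<phi> - \<Lambda> x \<circ> g\<close> has derivative \<open>0\<close> at \<open>x\<close>.  On the fibre through \<open>x\<close> the term with
  \<open>\<Lambda> x\<close> disappears; off the fibre it is the candidate for the derivative of the induced function.\<close>

lemma dependence_to_first_order:
  assumes x: "x \<in> ball x0 \<rho>" and "e > 0"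
  obtains d where "d > 0"
    "\<And>x'. norm (x' - x) < d \<Longrightarrow> \<bar>\<phi> x' - \<phi> x - \<Lambda> x (g x' - g x)\<bar> \<le> e * norm (x' - x)"
proof -
  have "((\<lambda>x'. \<phi> x' - \<Lambda> x (g x')) has_derivative (\<lambda>u. \<phi>' x u - \<Lambda> x (g' x u))) (at x)"
    by (intro derivative_intros \<phi>_deriv deriv x bounded_linear.has_derivative[OF blinfun.bounded_linear_right])
  then have "((\<lambda>x'. \<phi> x' - \<Lambda> x (g x')) has_derivative (\<lambda>u. 0)) (at x)"
    using \<Lambda>_apply[OF x] by simp
  then show ?thesis
    using \<open>e > 0\<close> that unfolding has_derivative_at_alt
    by (fastforce simp: blinfun.diff_right algebra_simps)
qed

text \<open>Descent towards \<open>y\<close> on the part of the fibre in a larger ball, with \<open>\<Phi> z = 2 * norm (z - y)\<close> and with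
  the multiple \<open>\<kappa> * \<phi>\<close> of \<open>\<phi>\<close> as recorded quantity.  Steps that are short enough change \<open>\<kappa> * \<phi>\<close> by at
  most their length, how short depending on the point, which the descent principle permits.  Hence
  \<open>\<kappa> * \<bar>\<phi> x - \<phi> y\<bar> \<le> 2 * norm (x - y)\<close> for all \<open>\<kappa>\<close>.\<close>

lemma constant_on_fibres:
  assumes x: "x \<in> ball x0 (\<rho> / 4)" and y: "y \<in> ball x0 (\<rho> / 4)" and "g x = g y"
  shows "\<phi> x = \<phi> y"
proof -
  have bound: "\<kappa> * \<bar>\<phi> x - \<phi> y\<bar> \<le> 2 * norm (x - y)" if "\<kappa> > 0" for \<kappa>
  proof -
    define M where "M = cball x0 (3 / 4 * \<rho>) \<inter> g -` {g y}"
    define \<Phi> where "\<Phi> z = 2 * norm (z - y)" for z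
    have cball: "cball x0 (3 / 4 * \<rho>) \<subseteq> ball x0 \<rho>" using \<rho> by auto
    have "continuous_on (cball x0 (3 / 4 * \<rho>)) g"
      using continuous_on_g cball by (rule continuous_on_subset)
    then have "closed M" unfolding M_def
      by (intro continuous_closed_preimage) auto
    moreover have "continuous_on M (\<lambda>z. \<kappa> * \<phi> z)"
      by (intro continuous_on_mult_left continuous_on_subset[OF continuous_on_\<phi>])
        (use cball in \<open>auto simp: M_def\<close>)
    moreover have "continuous_on M \<Phi>" unfolding \<Phi>_def by (intro continuous_intros)
    moreover have "x \<in> M" using x \<rho> \<open>g x = g y\<close> by (auto simp: M_def)
    moreover have "\<exists>z'\<in>M. z' \<noteq> z \<and> dist z z' \<le> \<Phi> z - \<Phi> z' \<and> dist (\<kappa> * \<phi> z) (\<kappa> * \<phi> z') \<le> \<Phi> z - \<Phi> z'"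
      if "z \<in> M" and desc: "dist x z \<le> \<Phi> x - \<Phi> z" and "\<Phi> z \<noteq> 0" for z
    proof -
      \<comment> \<open>The descent never moves away from \<open>y\<close>, so it stays within \<open>\<rho> / 4 + \<rho> / 2\<close> of \<open>x0\<close>.\<close>
      have ball: "w \<in> ball x0 (3 / 4 * \<rho>)" if "norm (w - y) \<le> norm (x - y)" for w
        using x y that dist_triangle[of x0 w y] dist_triangle[of x y x0]
        by (simp add: dist_norm norm_minus_commute)
      have zy: "norm (z - y) \<le> norm (x - y)" using desc zero_le_dist[of x z] unfolding \<Phi>_def by linarith
      then have z: "z \<in> ball x0 (3 / 4 * \<rho>)" by (rule ball)
      then have z_ball: "z \<in> ball x0 \<rho>" using \<rho> by simp
      have gz: "g z = g y" using \<open>z \<in> M\<close> by (simp add: M_def)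
      obtain d where d: "d > 0" "\<And>x'. norm (x' - z) < d \<Longrightarrow>
          \<bar>\<phi> x' - \<phi> z - \<Lambda> z (g x' - g z)\<bar> \<le> 1 / \<kappa> * norm (x' - z)"
        using dependence_to_first_order[OF z_ball, of "1 / \<kappa>"] \<open>\<kappa> > 0\<close> by auto
      obtain z' where z': "g z' = g y" "norm (z' - y) + norm (z' - z) / 2 \<le> norm (z - y)"
          "z' \<noteq> z" "norm (z' - z) < d"
        using fibre_step_towards[OF z _ gz _ d(1)] y \<rho> \<open>\<Phi> z \<noteq> 0\<close> by (auto simp: \<Phi>_def)
      have "\<kappa> * \<bar>\<phi> z' - \<phi> z\<bar> \<le> norm (z' - z)"
        using d(2)[OF z'(4)] z'(1) gz \<open>\<kappa> > 0\<close> by (simp add: field_simps)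
      moreover have "dist (\<kappa> * \<phi> z) (\<kappa> * \<phi> z') = \<kappa> * \<bar>\<phi> z' - \<phi> z\<bar>"
        using \<open>\<kappa> > 0\<close> by (simp add: dist_real_def abs_mult abs_minus_commute flip: right_diff_distrib)
      moreover have "norm (z' - z) \<le> \<Phi> z - \<Phi> z'" using z'(2) by (simp add: \<Phi>_def)
      moreover have "norm (z' - y) \<le> norm (x - y)"
        using z'(2) zy norm_ge_zero[of "z' - z"] by linarith
      then have "z' \<in> M" using ball[of z'] z'(1) by (auto simp: M_def)
      ultimately show ?thesis using z'(3)
        by (intro bexI[of _ z']) (auto simp: dist_norm norm_minus_commute)
    qed
    ultimately obtain z where "\<Phi> z = 0" "dist (\<kappa> * \<phi> x) (\<kappa> * \<phi> z) \<le> \<Phi> x"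
      using descent_principle[of M x \<Phi> "\<lambda>z. \<kappa> * \<phi> z"]
      by (auto simp: complete_eq_closed \<Phi>_def)
    then show ?thesis
      using \<open>\<kappa> > 0\<close> by (simp add: \<Phi>_def dist_real_def abs_mult flip: right_diff_distrib)
  qed
  show ?thesis
  proof (rule ccontr)
    assume "\<phi> x \<noteq> \<phi> y"
    then have pos: "\<bar>\<phi> x - \<phi> y\<bar> > 0" by simp
    have "(2 * norm (x - y) + 1) / \<bar>\<phi> x - \<phi> y\<bar> * \<bar>\<phi> x - \<phi> y\<bar> \<le> 2 * norm (x - y)"
      using pos by (intro bound divide_pos_pos add_nonneg_pos) auto
    then show False using pos by simp
  qed
qed

definition fibre_point :: "'b \<Rightarrow> 'a" where
  "fibre_point c = (SOME x. x \<in> ball x0 (\<rho> / 4) \<and> g x = c)"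

lemma fibre_point:
  assumes "x \<in> ball x0 (\<rho> / 4)"
  shows "fibre_point (g x) \<in> ball x0 (\<rho> / 4)" "g (fibre_point (g x)) = g x"
  using someI[of "\<lambda>z. z \<in> ball x0 (\<rho> / 4) \<and> g z = g x" x] assms by (auto simp: fibre_point_def)

lemma \<phi>_fibre_point: "x \<in> ball x0 (\<rho> / 4) \<Longrightarrow> \<phi> (fibre_point (g x)) = \<phi> x"
  using fibre_point constant_on_fibres by blast

text \<open>Values near \<open>g x\<close> are attained near \<open>x\<close>, with linear control of the distance.  This replaces a
  continuous local section of \<open>g\<close> in the proofs about the induced function.\<close>

lemma lift_nearby:
  assumes x: "x \<in> ball x0 (\<rho> / 4)" and "e > 0"
  obtains d where "d > 0" "\<And>c. norm (c - g x) < d \<Longrightarrow>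
    \<exists>x'\<in>ball x0 (\<rho> / 4). g x' = c \<and> norm (x' - x) \<le> 2 * C * norm (c - g x) \<and> norm (x' - x) < e"
proof -
  define m where "m = min e (\<rho> / 4 - dist x0 x)"
  have m: "m > 0" "m \<le> e" "m \<le> \<rho> / 4 - dist x0 x" using assms by (auto simp: m_def)
  have "\<exists>x'\<in>ball x0 (\<rho> / 4). g x' = c \<and> norm (x' - x) \<le> 2 * C * norm (c - g x) \<and> norm (x' - x) < e"
    if "norm (c - g x) < m / (2 * C)" for c
  proof -
    have *: "2 * C * norm (g x - c) < m"
      using that C by (simp add: field_simps norm_minus_commute)
    with m \<rho> have "dist x0 x + 2 * C * norm (g x - c) < \<rho>" by linarith
    from metric_regularity[OF this] obtain x' where
      x': "g x' = c" "norm (x' - x) \<le> 2 * C * norm (g x - c)" by blast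
    have "dist x0 x' \<le> dist x0 x + norm (x' - x)"
      using dist_triangle[of x0 x' x] by (simp add: dist_norm norm_minus_commute)
    then show ?thesis using x' * m by (intro bexI[of _ x']) (auto simp: norm_minus_commute)
  qed
  then show ?thesis using m(1) C by (intro that[of "m / (2 * C)"]) auto
qed

text \<open>For \<open>c\<close> near \<open>g x\<close>, the value \<open>\<phi> (fibre_point c)\<close> may be computed at any point of the fibre over
  \<open>c\<close>.  Taking the one close to \<open>x\<close>, the first order dependence of \<open>\<phi>\<close> on \<open>g\<close> becomes the claim.\<close>

lemma has_derivative_\<phi>_fibre_point:
  assumes x: "x \<in> ball x0 (\<rho> / 4)"
  shows "((\<lambda>c. \<phi> (fibre_point c)) has_derivative \<Lambda> x) (at (g x))"
  unfolding has_derivative_at_alt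
proof (intro conjI allI impI)
  show "bounded_linear (blinfun_apply (\<Lambda> x))" by (rule blinfun.bounded_linear_right)
  fix e :: real assume "e > 0"
  have x_ball: "x \<in> ball x0 \<rho>" using x \<rho> by simp
  obtain d1 where d1: "d1 > 0" "\<And>x'. norm (x' - x) < d1 \<Longrightarrow>
      \<bar>\<phi> x' - \<phi> x - \<Lambda> x (g x' - g x)\<bar> \<le> e / (2 * C) * norm (x' - x)"
    using dependence_to_first_order[OF x_ball, of "e / (2 * C)"] \<open>e > 0\<close> C by auto
  obtain d where d: "d > 0" "\<And>c. norm (c - g x) < d \<Longrightarrow> \<exists>x'\<in>ball x0 (\<rho> / 4).
      g x' = c \<and> norm (x' - x) \<le> 2 * C * norm (c - g x) \<and> norm (x' - x) < d1"
    using lift_nearby[OF x d1(1)] by blast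
  have "norm (\<phi> (fibre_point c) - \<phi> (fibre_point (g x)) - \<Lambda> x (c - g x)) \<le> e * norm (c - g x)"
    if c: "norm (c - g x) < d" for c
  proof -
    obtain x' where x': "x' \<in> ball x0 (\<rho> / 4)" "g x' = c"
      "norm (x' - x) \<le> 2 * C * norm (c - g x)" "norm (x' - x) < d1" using d(2)[OF c] by blast
    have "norm (\<phi> (fibre_point c) - \<phi> (fibre_point (g x)) - \<Lambda> x (c - g x)) \<le> e / (2 * C) * norm (x' - x)"
      using d1(2)[OF x'(4)] \<phi>_fibre_point[OF x'(1)] \<phi>_fibre_point[OF x] x'(2) by simp
    also have "\<dots> \<le> e / (2 * C) * (2 * C * norm (c - g x))"
      using x'(3) \<open>e > 0\<close> C by (intro mult_left_mono) auto
    also have "\<dots> = e * norm (c - g x)" using C by simp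
    finally show ?thesis .
  qed
  then show "\<exists>d>0. \<forall>c. norm (c - g x) < d \<longrightarrow>
      norm (\<phi> (fibre_point c) - \<phi> (fibre_point (g x)) - \<Lambda> x (c - g x)) \<le> e * norm (c - g x)"
    using d(1) by blast
qed

text \<open>Both sides are the derivative of the induced function at \<open>g x\<close>.\<close>

lemma \<Lambda>_fibre_point:
  assumes x: "x \<in> ball x0 (\<rho> / 4)"
  shows "\<Lambda> (fibre_point (g x)) = \<Lambda> x"
proof (rule blinfun_eqI)
  have "((\<lambda>c. \<phi> (fibre_point c)) has_derivative \<Lambda> (fibre_point (g x))) (at (g x))"
    using has_derivative_\<phi>_fibre_point[of "fibre_point (g x)"] fibre_point[OF x] by simp
  from has_derivative_unique[OF this has_derivative_\<phi>_fibre_point[OF x]]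
  show "\<Lambda> (fibre_point (g x)) u = \<Lambda> x u" for u by simp
qed

text \<open>With \<open>y = g' z u\<close>, the difference of \<open>\<Lambda> z\<close> and \<open>\<Lambda> x\<close> at \<open>y\<close> is
  \<open>(\<phi>' z - \<phi>' x) u - \<Lambda> x ((g' z - g' x) u)\<close>, and \<open>u\<close> can be chosen of norm at most \<open>C * norm y\<close>.\<close>

lemma isCont_\<Lambda>:
  assumes x: "x \<in> ball x0 \<rho>" and "isCont g' x" "isCont \<phi>' x"
  shows "isCont \<Lambda> x"
proof -
  have bound: "norm (\<Lambda> z - \<Lambda> x) \<le> C * (norm (\<phi>' z - \<phi>' x) + norm (\<Lambda> x) * norm (g' z - g' x))"
    if z: "z \<in> ball x0 \<rho>" for z
  proof (rule norm_blinfun_bound)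
    show "0 \<le> C * (norm (\<phi>' z - \<phi>' x) + norm (\<Lambda> x) * norm (g' z - g' x))" using C by simp
    fix y
    obtain u where u: "g' z u = y" "norm u \<le> C * norm y"
      using onto[OF z] by (auto simp: onto_with_constant_def)
    have "(\<Lambda> z - \<Lambda> x) y = (\<phi>' z - \<phi>' x) u - \<Lambda> x ((g' z - g' x) u)"
      using \<Lambda>_apply[OF z, of u] \<Lambda>_apply[OF x, of u] u(1)
      by (simp add: blinfun.diff_left blinfun.diff_right)
    then have "norm ((\<Lambda> z - \<Lambda> x) y) \<le> norm ((\<phi>' z - \<phi>' x) u) + norm (\<Lambda> x ((g' z - g' x) u))"
      by (metis norm_triangle_ineq4)
    also have "norm ((\<phi>' z - \<phi>' x) u) \<le> norm (\<phi>' z - \<phi>' x) * norm u" by (rule norm_blinfun)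
    also have "norm (\<Lambda> x ((g' z - g' x) u)) \<le> norm (\<Lambda> x) * norm ((g' z - g' x) u)" by (rule norm_blinfun)
    also have "\<dots> \<le> norm (\<Lambda> x) * (norm (g' z - g' x) * norm u)"
      by (intro mult_left_mono norm_blinfun) auto
    also have "norm (\<phi>' z - \<phi>' x) * norm u + \<dots> = (norm (\<phi>' z - \<phi>' x) + norm (\<Lambda> x) * norm (g' z - g' x)) * norm u"
      by (simp add: algebra_simps)
    also have "\<dots> \<le> (norm (\<phi>' z - \<phi>' x) + norm (\<Lambda> x) * norm (g' z - g' x)) * (C * norm y)"
      by (intro mult_left_mono u) auto
    finally show "norm ((\<Lambda> z - \<Lambda> x) y) \<le> C * (norm (\<phi>' z - \<phi>' x) + norm (\<Lambda> x) * norm (g' z - g' x)) * norm y"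
      by (simp add: mult_ac)
  qed
  have "eventually (\<lambda>z. z \<in> ball x0 \<rho>) (at x)"
    using x by (intro eventually_at_in_open') auto
  then have "eventually (\<lambda>z. norm (\<Lambda> z - \<Lambda> x) \<le> C * (norm (\<phi>' z - \<phi>' x) + norm (\<Lambda> x) * norm (g' z - g' x))) (at x)"
    by (rule eventually_mono) (rule bound)
  moreover have "((\<lambda>z. C * (norm (\<phi>' z - \<phi>' x) + norm (\<Lambda> x) * norm (g' z - g' x))) \<longlongrightarrow>
      C * (norm (\<phi>' x - \<phi>' x) + norm (\<Lambda> x) * norm (g' x - g' x))) (at x)"
    using assms(2,3) unfolding isCont_def by (intro tendsto_intros)
  ultimately have "((\<lambda>z. \<Lambda> z - \<Lambda> x) \<longlongrightarrow> 0) (at x)"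
    by (auto intro: Lim_null_comparison)
  then show ?thesis unfolding isCont_def by (rule Lim_null[THEN iffD2])
qed

lemma continuous_on_\<Lambda>_fibre_point:
  assumes "continuous_on (ball x0 \<rho>) g'" "continuous_on (ball x0 \<rho>) \<phi>'"
  shows "continuous_on (g ` ball x0 (\<rho> / 4)) (\<lambda>c. \<Lambda> (fibre_point c))"
proof (rule continuous_at_imp_continuous_on, rule ballI, elim imageE)
  fix c x assume c: "c = g x" and x: "x \<in> ball x0 (\<rho> / 4)"
  have "isCont \<Lambda> x"
    using assms x \<rho> by (intro isCont_\<Lambda>) (auto simp: continuous_on_eq_continuous_at)
  show "isCont (\<lambda>c. \<Lambda> (fibre_point c)) c"
    unfolding continuous_at_eps_delta
  proof (intro allI impI)
    fix e :: real assume "e > 0"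
    obtain d1 where d1: "d1 > 0" "\<And>z. dist z x < d1 \<Longrightarrow> dist (\<Lambda> z) (\<Lambda> x) < e"
      using \<open>isCont \<Lambda> x\<close> \<open>e > 0\<close> unfolding continuous_at_eps_delta by blast
    obtain d where d: "d > 0" "\<And>c. norm (c - g x) < d \<Longrightarrow> \<exists>x'\<in>ball x0 (\<rho> / 4).
        g x' = c \<and> norm (x' - x) \<le> 2 * C * norm (c - g x) \<and> norm (x' - x) < d1"
      using lift_nearby[OF x d1(1)] by blast
    have "dist (\<Lambda> (fibre_point c')) (\<Lambda> (fibre_point c)) < e" if "dist c' c < d" for c'
    proof -
      obtain x' where "x' \<in> ball x0 (\<rho> / 4)" "g x' = c'" "norm (x' - x) < d1"
        using d(2)[of c'] \<open>dist c' c < d\<close> by (auto simp: dist_norm c)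
      then show ?thesis using d1(2)[of x'] x \<Lambda>_fibre_point[of x'] \<Lambda>_fibre_point[of x] by (simp add: dist_norm c)
    qed
    then show "\<exists>d>0. \<forall>c'. dist c' c < d \<longrightarrow> dist (\<Lambda> (fibre_point c')) (\<Lambda> (fibre_point c)) < e"
      using d(1) by blast
  qed
qed

lemma ball_subset_image: "ball (g x0) (\<rho> / (8 * C)) \<subseteq> g ` ball x0 (\<rho> / 4)"
proof
  fix c assume "c \<in> ball (g x0) (\<rho> / (8 * C))"
  then have c: "2 * C * norm (g x0 - c) < \<rho> / 4"
    using C by (simp add: dist_norm field_simps)
  then obtain x where "g x = c" "norm (x - x0) \<le> 2 * C * norm (g x0 - c)"
    using metric_regularity[of x0 c] \<rho> by auto
  then show "c \<in> g ` ball x0 (\<rho> / 4)"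
    using c by (intro image_eqI[of _ _ x]) (auto simp: dist_norm norm_minus_commute)
qed

end

section \<open>From local to global functions, and from onto to projected targets\<close>

definition C1_with ::
  "'a::real_normed_vector set \<Rightarrow> ('a \<Rightarrow> 'b::real_normed_vector) \<Rightarrow> ('a \<Rightarrow> 'a \<Rightarrow>\<^sub>L 'b) \<Rightarrow> bool" where
  "C1_with S f f' \<longleftrightarrow> (\<forall>x\<in>S. (f has_derivative f' x) (at x)) \<and> continuous_on S f'"

lemma C1_with_subset: "C1_with S f f' \<Longrightarrow> T \<subseteq> S \<Longrightarrow> C1_with T f f'"
  unfolding C1_with_def using continuous_on_subset by blast

lemma has_real_derivative_positive_part_squared:
  "((\<lambda>t. (max 0 t)\<^sup>2) has_real_derivative 2 * max 0 t) (at t)"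
  unfolding has_field_derivative_def has_derivative_at_alt
proof (intro conjI allI impI)
  show "bounded_linear ((*) (2 * max 0 t))" by (rule bounded_linear_mult_right)
  fix e :: real assume "e > 0"
  have "norm ((max 0 s)\<^sup>2 - (max 0 t)\<^sup>2 - 2 * max 0 t * (s - t)) \<le> e * norm (s - t)"
    if "norm (s - t) < e" for s
  proof -
    have "norm ((max 0 s)\<^sup>2 - (max 0 t)\<^sup>2 - 2 * max 0 t * (s - t)) \<le> (s - t)\<^sup>2"
    proof (cases "0 \<le> s")
      case True
      show ?thesis
      proof (cases "0 \<le> t")
        case t: True
        have "s\<^sup>2 - t\<^sup>2 - 2 * t * (s - t) = (s - t)\<^sup>2"
          by (simp add: power2_eq_square algebra_simps)
        with True t show ?thesis by simp
      next
        case False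
        then show ?thesis using power_mono[of s "s - t" 2] True by simp
      qed
    next
      case s: False
      show ?thesis
      proof (cases "0 \<le> t")
        case True
        have eq: "- (t\<^sup>2) - 2 * t * (s - t) = t\<^sup>2 + 2 * (t * - s)"
          "(s - t)\<^sup>2 = t\<^sup>2 + 2 * (t * - s) + s\<^sup>2"
          by (simp_all add: power2_eq_square algebra_simps)
        have "t * - s \<ge> 0" using True s by (intro mult_nonneg_nonneg) auto
        then have "\<bar>- (t\<^sup>2) - 2 * t * (s - t)\<bar> \<le> (s - t)\<^sup>2"
          unfolding eq using zero_le_power2[of t] zero_le_power2[of s] by linarith
        then show ?thesis using True s by simp
      qed (use s in simp)
    qed
    also have "(s - t)\<^sup>2 = norm (s - t) * norm (s - t)" by (simp add: power2_eq_square)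
    also have "\<dots> \<le> e * norm (s - t)" using that by (intro mult_right_mono) auto
    finally show ?thesis .
  qed
  then show "\<exists>d>0. \<forall>s. norm (s - t) < d \<longrightarrow>
      norm ((max 0 s)\<^sup>2 - (max 0 t)\<^sup>2 - 2 * max 0 t * (s - t)) \<le> e * norm (s - t)"
    using \<open>e > 0\<close> by blast
qed

text \<open>With \<open>p t = (max 0 t)\<^sup>2\<close> take \<open>1 - p (1 - p (2 - t))\<close>: for \<open>t \<le> 1\<close> the inner square is at least 1 and
  the outer one vanishes; for \<open>t \<ge> 2\<close> the inner square vanishes and the outer one is 1.\<close>

lemma C1_cutoff_real:
  obtains \<beta> \<beta>' :: "real \<Rightarrow> real"
  where "\<And>t. (\<beta> has_real_derivative \<beta>' t) (at t)" "continuous_on UNIV \<beta>'"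
    "\<And>t. t \<le> 1 \<Longrightarrow> \<beta> t = 1" "\<And>t. t \<ge> 2 \<Longrightarrow> \<beta> t = 0" "\<And>t. t \<ge> 2 \<Longrightarrow> \<beta>' t = 0"
proof -
  define p :: "real \<Rightarrow> real" where "p t = (max 0 t)\<^sup>2" for t
  define \<beta> where "\<beta> t = 1 - p (1 - p (2 - t))" for t
  define \<beta>' where "\<beta>' t = - (2 * max 0 (1 - p (2 - t)) * (2 * max 0 (2 - t)))" for t
  have p: "(p has_real_derivative 2 * max 0 t) (at t)" for t
    unfolding p_def by (rule has_real_derivative_positive_part_squared)
  show ?thesis
  proof (rule that[of \<beta> \<beta>'])
    show "(\<beta> has_real_derivative \<beta>' t) (at t)" for t
      unfolding \<beta>_def by (auto simp: \<beta>'_def intro!: derivative_eq_intros DERIV_chain'[OF _ p])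
    show "continuous_on UNIV \<beta>'"
      unfolding \<beta>'_def p_def by (intro continuous_intros)
    show "\<beta> t = 1" if "t \<le> 1" for t
    proof -
      have "1 \<le> p (2 - t)" using that by (simp add: p_def)
      then show ?thesis by (simp add: \<beta>_def p_def[of "1 - _"])
    qed
  qed (simp_all add: \<beta>_def \<beta>'_def p_def)
qed

text \<open>Multiply by a cutoff of the squared distance to the centre, which is smooth because the norm comes
  from an inner product.\<close>

lemma C1_extension_from_ball:
  fixes h :: "'b::real_inner \<Rightarrow> real"
  assumes "\<tau> > 0" and h: "C1_with (ball c \<tau>) h h'"
  obtains k k' where "C1_with UNIV k k'" "\<And>y. y \<in> ball c (\<tau> / 2) \<Longrightarrow> k y = h y"
proof -
  obtain \<beta> \<beta>' :: "real \<Rightarrow> real"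
    where \<beta>: "\<And>t. (\<beta> has_real_derivative \<beta>' t) (at t)" "continuous_on UNIV \<beta>'"
    "\<And>t. t \<le> 1 \<Longrightarrow> \<beta> t = 1" "\<And>t. t \<ge> 2 \<Longrightarrow> \<beta> t = 0" "\<And>t. t \<ge> 2 \<Longrightarrow> \<beta>' t = 0"
    by (rule C1_cutoff_real) blast
  \<comment> \<open>With this scaling \<open>q \<le> 1\<close> on the ball of radius \<open>\<tau> / 2\<close>, and \<open>q \<ge> 4\<close> outside the ball of radius \<open>\<tau>\<close>.\<close>
  define K where "K = 4 / \<tau>\<^sup>2"
  define q where "q y = K * ((y - c) \<bullet> (y - c))" for y
  define cut where "cut y = \<beta> (q y)" for y
  define cut' where "cut' y = (\<beta>' (q y) * (2 * K)) *\<^sub>R blinfun_inner_right (y - c)" for y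
  define k where "k y = (if y \<in> ball c \<tau> then cut y * h y else 0)" for y
  define k' where "k' y = (if y \<in> ball c \<tau> then cut y *\<^sub>R h' y + h y *\<^sub>R cut' y else 0)" for y
  define B where "B = {y. q y > 2}"
  have q: "(q has_derivative (\<lambda>u. 2 * K * ((y - c) \<bullet> u))) (at y)" for y
    unfolding q_def by (auto intro!: derivative_eq_intros simp: inner_commute algebra_simps)
  have q_cont: "continuous_on S q" for S
    unfolding q_def by (intro continuous_intros)
  have cut: "(cut has_derivative cut' y) (at y)" for y
    unfolding cut_def
    by (rule has_derivative_eq_rhs[OF has_derivative_compose[OF q has_field_derivative_imp_has_derivative[OF \<beta>(1)]]])
      (simp add: cut'_def blinfun.scaleR_left fun_eq_iff)
  have cut_cont: "continuous_on S cut" for S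
    by (rule has_derivative_continuous_on) (use cut has_derivative_at_withinI in blast)
  have cut'_cont: "continuous_on S cut'" for S
    unfolding cut'_def
    by (intro continuous_intros continuous_on_compose2[OF \<beta>(2) q_cont]
        bounded_linear.continuous_on[OF bounded_linear_blinfun_inner_right]) auto
  have h_cont: "continuous_on (ball c \<tau>) h"
    by (rule has_derivative_continuous_on[where f' = "\<lambda>y. blinfun_apply (h' y)"])
      (use h in \<open>auto simp: C1_with_def intro: has_derivative_at_withinI\<close>)
  have qn: "q y = (2 * norm (y - c) / \<tau>)\<^sup>2" for y
    by (simp add: q_def K_def power2_norm_eq_inner power_divide power_mult_distrib)
  have "open B" unfolding B_def
    by (intro open_Collect_less continuous_intros q_cont)
  have "y \<in> B" if "y \<notin> ball c \<tau>" for y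
  proof -
    have "2 * norm (y - c) / \<tau> \<ge> 2"
      using that \<open>\<tau> > 0\<close> by (simp add: dist_norm norm_minus_commute field_simps)
    from power_mono[OF this, of 2] show ?thesis by (simp add: B_def qn)
  qed
  then have cover: "ball c \<tau> \<union> B = UNIV" by blast
  have B0: "k y = 0" "k' y = 0" if "y \<in> B" for y
    using that \<beta>(4,5)[of "q y"] by (auto simp: B_def k_def k'_def cut_def cut'_def)
  have "(k has_derivative k' y) (at y)" for y
  proof (cases "y \<in> ball c \<tau>")
    case True
    then have "((\<lambda>y. cut y * h y) has_derivative (\<lambda>u. cut y * h' y u + cut' y u * h y)) (at y)"
      using h by (intro has_derivative_mult cut) (auto simp: C1_with_def)
    then have "((\<lambda>y. cut y * h y) has_derivative k' y) (at y)"
      by (rule has_derivative_eq_rhs)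
        (use True in \<open>simp add: k'_def blinfun.add_left blinfun.scaleR_left fun_eq_iff mult_ac\<close>)
    from has_derivative_transform_within_open[OF this open_ball True] show ?thesis
      by (simp add: k_def)
  next
    case False
    then have y: "y \<in> B" using cover by blast
    have "((\<lambda>y. 0) has_derivative k' y) (at y)" by (simp add: B0[OF y] zero_blinfun.rep_eq)
    from has_derivative_transform_within_open[OF this \<open>open B\<close> y] B0 show ?thesis by simp
  qed
  moreover have "continuous_on UNIV k'"
  proof -
    have "continuous_on (ball c \<tau>) (\<lambda>y. cut y *\<^sub>R h' y + h y *\<^sub>R cut' y)"
      using h by (intro continuous_intros cut_cont cut'_cont h_cont) (simp add: C1_with_def)
    then have "continuous_on (ball c \<tau>) k'" by (simp add: k'_def cong: continuous_on_cong_simp)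
    moreover have "continuous_on B k'"
      using B0(2) by (simp cong: continuous_on_cong_simp)
    ultimately have "continuous_on (ball c \<tau> \<union> B) k'"
      using \<open>open B\<close> by (intro continuous_on_open_Un) auto
    then show ?thesis using cover by simp
  qed
  moreover have "k y = h y" if "y \<in> ball c (\<tau> / 2)" for y
  proof -
    have "2 * norm (y - c) / \<tau> \<le> 1" using that \<open>\<tau> > 0\<close> by (simp add: dist_norm norm_minus_commute)
    then have "q y \<le> 1" using \<open>\<tau> > 0\<close> by (simp add: qn power_le_one)
    then show ?thesis using that \<open>\<tau> > 0\<close> by (simp add: k_def cut_def \<beta>(3))
  qed
  ultimately show ?thesis by (intro that[of k k']) (auto simp: C1_with_def)
qed

text \<open>The neighbourhood \<open>W\<close> depends on \<open>g\<close> alone, so it serves all dependent functions at once.  Restricting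
  to a small ball makes \<open>g\<close> a near-submersion with constant \<open>C = 2 * C0\<close>, and \<open>W\<close> is cut down further so
  that \<open>g\<close> maps it into the ball on which the cutoff is 1.\<close>

lemma functional_dependence_submersion:
  fixes g :: "'a::banach \<Rightarrow> 'b::{real_inner, complete_space}" and x0 :: 'a
  assumes "open U" "x0 \<in> U" and g: "C1_with U g g'" and surj: "surj (blinfun_apply (g' x0))"
  shows "\<exists>W. open W \<and> x0 \<in> W \<and> W \<subseteq> U \<and>
    (\<forall>(\<phi> :: 'a \<Rightarrow> real) \<phi>'. C1_with U \<phi> \<phi>' \<longrightarrow> (\<forall>x\<in>U. \<forall>u. g' x u = 0 \<longrightarrow> \<phi>' x u = 0) \<longrightarrow>
      (\<exists>h h'. C1_with UNIV h h' \<and> (\<forall>x\<in>W. \<phi> x = h (g x))))"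
proof -
  obtain C0 where C0: "onto_with_constant C0 (g' x0)" using open_mapping[OF surj] .
  define C where "C = 2 * C0"
  have C: "C > 0" using C0 by (simp add: C_def onto_with_constant_def)
  have "isCont g' x0"
    using g assms(1,2) by (simp add: C1_with_def continuous_on_eq_continuous_at)
  \<comment> \<open>Comparing two points of the ball through \<open>x0\<close> doubles this bound to \<open>1 / (8 * C)\<close>.\<close>
  then obtain d where d: "d > 0" "\<And>x. dist x x0 < d \<Longrightarrow> dist (g' x) (g' x0) < 1 / (16 * C)"
    unfolding continuous_at_eps_delta using C by (metis divide_pos_pos mult_pos_pos zero_less_numeral zero_less_one)
  obtain r where r: "r > 0" "ball x0 r \<subseteq> U" using assms(1,2) openE by blast
  define \<rho> where "\<rho> = min d r"
  have close: "16 * C * norm (g' x - g' x0) \<le> 1" if "x \<in> ball x0 \<rho>" for x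
    using d(2)[of x] that C by (simp add: \<rho>_def dist_norm field_simps norm_minus_commute)
  have sub: "ball x0 \<rho> \<subseteq> U" using r by (auto simp: \<rho>_def)
  have near_submersion: "near_submersion g g' x0 \<rho> C"
  proof
    show "\<rho> > 0" using d r by (simp add: \<rho>_def)
    show "(g has_derivative g' x) (at x)" if "x \<in> ball x0 \<rho>" for x
      using g sub that by (auto simp: C1_with_def)
    show "onto_with_constant C (g' x)" if "x \<in> ball x0 \<rho>" for x
      using close[OF that] C norm_ge_zero[of "g' x - g' x0"] unfolding C_def
      by (intro onto_with_constant_perturb[OF C0]) (simp add: C_def)
    show "8 * C * norm (g' x - g' y) \<le> 1" if "x \<in> ball x0 \<rho>" "y \<in> ball x0 \<rho>" for x y
    proof -
      have "norm (g' x - g' y) \<le> norm (g' x - g' x0) + norm (g' y - g' x0)"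
        using norm_triangle_ineq4[of "g' x - g' x0" "g' y - g' x0"] by simp
      then have "C * norm (g' x - g' y) \<le> C * norm (g' x - g' x0) + C * norm (g' y - g' x0)"
        using C by (simp flip: distrib_left)
      then show ?thesis using close[OF that(1)] close[OF that(2)] by simp
    qed
  qed
  then interpret near_submersion g g' x0 \<rho> C .
  define \<tau> where "\<tau> = \<rho> / (8 * C)"
  have \<tau>: "\<tau> > 0" using \<rho> C by (simp add: \<tau>_def)
  define W where "W = ball x0 (\<rho> / 4) \<inter> g -` ball (g x0) (\<tau> / 2)"
  have "ball x0 (\<rho> / 4) \<subseteq> ball x0 \<rho>" using \<rho> by auto
  then have "continuous_on (ball x0 (\<rho> / 4)) g" using continuous_on_g continuous_on_subset by blast
  then have "open W" unfolding W_def by (intro continuous_open_preimage) auto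
  moreover have "x0 \<in> W" using \<rho> \<tau> by (simp add: W_def)
  moreover have "W \<subseteq> U" using sub \<open>ball x0 (\<rho> / 4) \<subseteq> ball x0 \<rho>\<close> by (auto simp: W_def)
  moreover have "\<exists>h h'. C1_with UNIV h h' \<and> (\<forall>x\<in>W. \<phi> x = h (g x))"
    if \<phi>: "C1_with U \<phi> \<phi>'" and ker: "\<forall>x\<in>U. \<forall>u. g' x u = 0 \<longrightarrow> \<phi>' x u = 0" for \<phi> :: "'a \<Rightarrow> real" and \<phi>'
  proof -
    interpret near_submersion_dependent g g' x0 \<rho> C \<phi> \<phi>'
      using \<phi> ker sub by unfold_locales (auto simp: C1_with_def)
    have "C1_with (g ` ball x0 (\<rho> / 4)) (\<lambda>c. \<phi> (fibre_point c)) (\<lambda>c. \<Lambda> (fibre_point c))"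
      unfolding C1_with_def
    proof (intro conjI ballI)
      show "((\<lambda>c. \<phi> (fibre_point c)) has_derivative \<Lambda> (fibre_point c)) (at c)"
        if "c \<in> g ` ball x0 (\<rho> / 4)" for c
        using that has_derivative_\<phi>_fibre_point \<Lambda>_fibre_point by auto
      show "continuous_on (g ` ball x0 (\<rho> / 4)) (\<lambda>c. \<Lambda> (fibre_point c))"
        using C1_with_subset[OF g sub] C1_with_subset[OF \<phi> sub]
        by (intro continuous_on_\<Lambda>_fibre_point) (auto simp: C1_with_def)
    qed
    then have "C1_with (ball (g x0) \<tau>) (\<lambda>c. \<phi> (fibre_point c)) (\<lambda>c. \<Lambda> (fibre_point c))"
      using ball_subset_image unfolding \<tau>_def by (rule C1_with_subset)
    from C1_extension_from_ball[OF \<tau> this] obtain k k' where k: "C1_with UNIV k k'"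
      "\<And>y. y \<in> ball (g x0) (\<tau> / 2) \<Longrightarrow> k y = \<phi> (fibre_point y)" by blast
    have "\<phi> x = k (g x)" if "x \<in> W" for x
      using that k(2)[of "g x"] \<phi>_fibre_point[of x] by (simp add: W_def)
    then show ?thesis using k(1) by blast
  qed
  ultimately show ?thesis by blast
qed

text \<open>Here \<open>Dg(x0)\<close> is only onto the range of a projection \<open>Q\<close>, in which all derivatives take their values.
  The map \<open>(x, w) \<mapsto> g x + (w - Q w)\<close> is onto at \<open>(x0, 0)\<close>, and its derivative vanishes at
  \<open>(u, w)\<close> only if that of \<open>g\<close> vanishes at \<open>u\<close>, as one sees by applying \<open>Q\<close>.  So the map
  and the function \<open>(x, w) \<mapsto> \<phi> x\<close> fall under the case of onto derivatives, and setting \<open>w = 0\<close> gives the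
  claim.\<close>

lemma functional_dependence:
  fixes g :: "'a::banach \<Rightarrow> 'b::{real_inner, banach}" and x0 :: 'a
    and Q :: "'b \<Rightarrow>\<^sub>L 'b"
  assumes "open U" "x0 \<in> U" and g: "C1_with U g g'"
    and Q: "\<And>y. Q (Q y) = Q y" and gQ: "\<And>x u. x \<in> U \<Longrightarrow> Q (g' x u) = g' x u"
    and onto: "\<And>y. \<exists>u. g' x0 u = Q y"
  shows "\<exists>W. open W \<and> x0 \<in> W \<and> W \<subseteq> U \<and>
    (\<forall>(\<phi> :: 'a \<Rightarrow> real) \<phi>'. C1_with U \<phi> \<phi>' \<longrightarrow> (\<forall>x\<in>U. \<forall>u. g' x u = 0 \<longrightarrow> \<phi>' x u = 0) \<longrightarrow>
      (\<exists>h h'. C1_with UNIV h h' \<and> (\<forall>x\<in>W. \<phi> x = h (g x))))"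
proof -
  define G where "G = (\<lambda>(x, w). g x + (w - Q w))"
  define G' where "G' z = (g' (fst z) o\<^sub>L fst_blinfun) + ((id_blinfun - Q) o\<^sub>L snd_blinfun)" for z :: "'a \<times> 'b"
  have G'_apply: "G' z v = g' (fst z) (fst v) + (snd v - Q (snd v))" for z v
    by (simp add: G'_def blinfun.add_left blinfun.diff_left)
  have C1_fst: "((\<lambda>z. f (fst z)) has_derivative (\<lambda>v. f' (fst z) (fst v))) (at z)"
    if "C1_with U f f'" "z \<in> U \<times> UNIV" for f :: "'a \<Rightarrow> 'c::real_normed_vector" and f' and z :: "'a \<times> 'b"
  proof -
    have "(f has_derivative f' (fst z)) (at (fst z))" using that by (auto simp: C1_with_def)
    from has_derivative_compose[OF has_derivative_fst[OF has_derivative_ident] this] show ?thesis .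
  qed
  have cont_fst: "continuous_on (U \<times> UNIV) (\<lambda>z::'a \<times> 'b. f' (fst z) o\<^sub>L fst_blinfun)"
    if "C1_with U f f'" for f :: "'a \<Rightarrow> 'c::real_normed_vector" and f'
  proof (rule bounded_bilinear.continuous_on[OF bounded_bilinear_blinfun_compose])
    show "continuous_on (U \<times> UNIV) (\<lambda>z::'a \<times> 'b. f' (fst z))"
      by (rule continuous_on_compose2[of U f']) (use that in \<open>auto simp: C1_with_def intro!: continuous_intros\<close>)
  qed (rule continuous_on_const)
  have G: "C1_with (U \<times> UNIV) G G'"
    unfolding C1_with_def
  proof (intro conjI ballI)
    fix z :: "'a \<times> 'b" assume z: "z \<in> U \<times> UNIV"
    have "((\<lambda>z. g (fst z) + (snd z - Q (snd z))) has_derivative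
        (\<lambda>v. g' (fst z) (fst v) + (snd v - Q (snd v)))) (at z)"
      by (intro derivative_intros C1_fst[OF g z] bounded_linear.has_derivative[OF blinfun.bounded_linear_right])
    then show "(G has_derivative G' z) (at z)"
      by (simp add: G_def case_prod_unfold G'_apply[abs_def])
  next
    show "continuous_on (U \<times> UNIV) G'"
      unfolding G'_def by (intro continuous_intros cont_fst[OF g])
  qed
  have surj: "surj (blinfun_apply (G' (x0, 0)))"
  proof (rule surjI)
    fix y
    show "G' (x0, 0) (SOME u. g' x0 u = Q y, y) = y"
      using someI_ex[OF onto[of y]] by (simp add: G'_apply)
  qed
  have "open (U \<times> (UNIV :: 'b set))" using \<open>open U\<close> by (intro open_Times) auto
  moreover have "(x0, 0) \<in> U \<times> (UNIV :: 'b set)" using \<open>x0 \<in> U\<close> by simp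
  ultimately obtain W where W: "open W" "(x0, 0) \<in> W" "W \<subseteq> U \<times> UNIV" and
    dep: "\<forall>\<phi> \<phi>'. C1_with (U \<times> UNIV) \<phi> \<phi>' \<longrightarrow>
      (\<forall>z\<in>U \<times> UNIV. \<forall>v. G' z v = 0 \<longrightarrow> blinfun_apply (\<phi>' z) v = 0) \<longrightarrow>
      (\<exists>h h'. C1_with UNIV h (h' :: 'b \<Rightarrow> 'b \<Rightarrow>\<^sub>L real) \<and> (\<forall>z\<in>W. \<phi> z = h (G z)))"
    using functional_dependence_submersion[OF _ _ G surj] by blast
  define W0 where "W0 = (\<lambda>x. (x, 0)) -` W"
  have "open W0" unfolding W0_def
    by (rule open_vimage[OF W(1)]) (intro continuous_intros)
  moreover have "x0 \<in> W0" "W0 \<subseteq> U" using W by (auto simp: W0_def)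
  moreover have "\<exists>h h'. C1_with UNIV h h' \<and> (\<forall>x\<in>W0. \<phi> x = h (g x))"
    if \<phi>: "C1_with U \<phi> \<phi>'" and ker: "\<forall>x\<in>U. \<forall>u. g' x u = 0 \<longrightarrow> \<phi>' x u = 0" for \<phi> :: "'a \<Rightarrow> real" and \<phi>'
  proof -
    have "\<exists>h h'. C1_with UNIV h h' \<and> (\<forall>z\<in>W. \<phi> (fst z) = h (G z))"
    proof (rule dep[rule_format, where \<phi>' = "\<lambda>z. \<phi>' (fst z) o\<^sub>L fst_blinfun"])
      show "C1_with (U \<times> UNIV) (\<lambda>z::'a \<times> 'b. \<phi> (fst z)) (\<lambda>z. \<phi>' (fst z) o\<^sub>L fst_blinfun)"
      proof -
        have "blinfun_apply (\<phi>' x o\<^sub>L fst_blinfun) = (\<lambda>v::'a \<times> 'b. \<phi>' x (fst v))" for x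
          by auto
        then show ?thesis using C1_fst[OF \<phi>] cont_fst[OF \<phi>] by (simp add: C1_with_def)
      qed
      fix z v assume z: "z \<in> U \<times> (UNIV :: 'b set)" and v: "G' z v = 0"
      have "Q (G' z v) = g' (fst z) (fst v)"
        using z by (auto simp: G'_apply blinfun.add_right blinfun.diff_right Q gQ)
      then have "g' (fst z) (fst v) = 0" using v by simp
      then show "(\<phi>' (fst z) o\<^sub>L fst_blinfun) v = 0" using ker z by auto
    qed
    then show ?thesis by (fastforce simp: W0_def G_def)
  qed
  ultimately show ?thesis by blast
qed

section \<open>The Hilbert space of square-summable sequences\<close>

definition square_summable :: "(nat \<Rightarrow> real) \<Rightarrow> bool" where
  "square_summable a \<longleftrightarrow> summable (\<lambda>i. (a i)\<^sup>2)"

lemma square_summable_mult: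
  assumes "square_summable a" "square_summable b"
  shows "summable (\<lambda>i. a i * b i)"
proof (rule summable_comparison_test'[where N = 0])
  show "summable (\<lambda>i. (a i)\<^sup>2 + (b i)\<^sup>2)"
    using assms by (intro summable_add) (simp_all add: square_summable_def)
  fix i
  show "norm (a i * b i) \<le> (a i)\<^sup>2 + (b i)\<^sup>2"
  proof -
    have "2 * (\<bar>a i\<bar> * \<bar>b i\<bar>) \<le> (a i)\<^sup>2 + (b i)\<^sup>2"
      using sum_squares_bound[of "\<bar>a i\<bar>" "\<bar>b i\<bar>"] by (simp add: mult.assoc)
    moreover have "\<bar>a i\<bar> * \<bar>b i\<bar> \<ge> 0" by simp
    ultimately show ?thesis unfolding real_norm_def abs_mult by linarith
  qed
qed

lemma square_summable_add: "square_summable (\<lambda>i. a i + b i)"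
  if "square_summable a" "square_summable b"
proof -
  have "summable (\<lambda>i. (a i)\<^sup>2 + (b i)\<^sup>2 + 2 * (a i * b i))"
    using that square_summable_mult[OF that]
    by (intro summable_add summable_mult) (simp_all add: square_summable_def)
  then show ?thesis by (simp add: square_summable_def power2_sum mult.assoc)
qed

lemma square_summable_scale: "square_summable a \<Longrightarrow> square_summable (\<lambda>i. r * a i)"
  by (simp add: square_summable_def power_mult_distrib summable_mult)

lemma square_summable_diff: "square_summable a \<Longrightarrow> square_summable b \<Longrightarrow> square_summable (\<lambda>i. a i - b i)"
  using square_summable_add[of a "\<lambda>i. - 1 * b i"] square_summable_scale[of b "- 1"] by simp

lemma square_summable_ext0: "square_summable a \<Longrightarrow> square_summable (ext0 J a)"
  unfolding square_summable_def
  by (rule summable_comparison_test'[where N = 0]) (auto simp: ext0_def)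

typedef ell2 = "Collect square_summable"
  morphisms coord Abs_ell2
  by (rule exI[of _ "\<lambda>_. 0"]) (simp add: square_summable_def)

setup_lifting type_definition_ell2

lemma square_summable_coord: "square_summable (coord x)"
  using coord[of x] by simp

lemma coord_Abs_ell2: "square_summable a \<Longrightarrow> coord (Abs_ell2 a) = a"
  by (simp add: Abs_ell2_inverse)

instantiation ell2 :: real_vector
begin

lift_definition zero_ell2 :: ell2 is "\<lambda>_. 0" by (simp add: square_summable_def)
lift_definition plus_ell2 :: "ell2 \<Rightarrow> ell2 \<Rightarrow> ell2" is "\<lambda>a b i. a i + b i"
  by (simp add: square_summable_add)
lift_definition minus_ell2 :: "ell2 \<Rightarrow> ell2 \<Rightarrow> ell2" is "\<lambda>a b i. a i - b i"
  by (simp add: square_summable_diff)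
lift_definition uminus_ell2 :: "ell2 \<Rightarrow> ell2" is "\<lambda>a i. - a i"
  by (simp add: square_summable_def)
lift_definition scaleR_ell2 :: "real \<Rightarrow> ell2 \<Rightarrow> ell2" is "\<lambda>r a i. r * a i"
  by (simp add: square_summable_scale)

instance
  by standard (transfer; simp add: fun_eq_iff algebra_simps)+

end

instantiation ell2 :: real_inner
begin

definition inner_ell2 :: "ell2 \<Rightarrow> ell2 \<Rightarrow> real" where
  "inner_ell2 x y = (\<Sum>i. coord x i * coord y i)"
definition norm_ell2 :: "ell2 \<Rightarrow> real" where "norm_ell2 x = sqrt (inner x x)"
definition sgn_ell2 :: "ell2 \<Rightarrow> ell2" where "sgn_ell2 x = x /\<^sub>R norm x"
definition dist_ell2 :: "ell2 \<Rightarrow> ell2 \<Rightarrow> real" where "dist_ell2 x y = norm (x - y)"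
definition uniformity_ell2 :: "(ell2 \<times> ell2) filter" where
  "uniformity_ell2 = (INF e\<in>{0<..}. principal {(x, y). dist x y < e})"
definition open_ell2 :: "ell2 set \<Rightarrow> bool" where
  "open_ell2 U \<longleftrightarrow> (\<forall>x\<in>U. eventually (\<lambda>(x', y). x' = x \<longrightarrow> y \<in> U) uniformity)"

instance
proof
  fix x y z :: ell2 and r :: real and U :: "ell2 set"
  show "dist x y = norm (x - y)" by (rule dist_ell2_def)
  show "sgn x = x /\<^sub>R norm x" by (rule sgn_ell2_def)
  show "uniformity = (INF e\<in>{0<..}. principal {(x, y). dist (x::ell2) y < e})"
    by (rule uniformity_ell2_def)
  show "open U \<longleftrightarrow> (\<forall>x\<in>U. \<forall>\<^sub>F (x', y) in uniformity. x' = x \<longrightarrow> y \<in> U)"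
    by (rule open_ell2_def)
  show "inner x y = inner y x" by (simp add: inner_ell2_def mult.commute)
  show "inner (x + y) z = inner x z + inner y z"
    unfolding inner_ell2_def plus_ell2.rep_eq
    by (simp add: distrib_right suminf_add square_summable_mult square_summable_coord)
  show "inner (r *\<^sub>R x) y = r * inner x y"
    unfolding inner_ell2_def scaleR_ell2.rep_eq
    by (simp add: mult.assoc suminf_mult square_summable_mult square_summable_coord)
  show "0 \<le> inner x x"
    unfolding inner_ell2_def by (intro suminf_nonneg square_summable_mult square_summable_coord) simp
  show "inner x x = 0 \<longleftrightarrow> x = 0"
    unfolding inner_ell2_def
    by (subst suminf_eq_zero_iff)
      (auto simp: square_summable_mult square_summable_coord coord_inject[symmetric] zero_ell2.rep_eq fun_eq_iff)
  show "norm x = sqrt (inner x x)" by (rule norm_ell2_def)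
qed

end

lemmas coord_simps [simp] =
  zero_ell2.rep_eq plus_ell2.rep_eq minus_ell2.rep_eq uminus_ell2.rep_eq scaleR_ell2.rep_eq

lemma ell2_eqI: "(\<And>i. coord x i = coord y i) \<Longrightarrow> x = y"
  by (metis coord_inject ext)

lemma norm_ell2_squared: "(norm x)\<^sup>2 = (\<Sum>i. (coord x i)\<^sup>2)"
  unfolding power2_norm_eq_inner inner_ell2_def by (simp add: power2_eq_square)

lemma sum_coord_le: "(\<Sum>i<N. (coord x i)\<^sup>2) \<le> (norm x)\<^sup>2"
  unfolding norm_ell2_squared
  using square_summable_coord[of x] by (intro sum_le_suminf) (auto simp: square_summable_def)

lemma abs_coord_le: "\<bar>coord x i\<bar> \<le> norm x"
proof -
  have "(coord x i)\<^sup>2 \<le> (\<Sum>j<Suc i. (coord x j)\<^sup>2)" by (simp add: sum_nonneg)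
  also have "\<dots> \<le> (norm x)\<^sup>2" by (rule sum_coord_le)
  finally show ?thesis by (simp add: power2_le_iff_abs_le)
qed

lemma norm_ell2_le:
  assumes "\<And>N. (\<Sum>i<N. (coord x i)\<^sup>2) \<le> e\<^sup>2" "e \<ge> 0"
  shows "norm x \<le> e"
proof -
  have "(norm x)\<^sup>2 \<le> e\<^sup>2"
    unfolding norm_ell2_squared
    using square_summable_coord[of x] assms(1) by (intro suminf_le_const) (auto simp: square_summable_def)
  then show ?thesis using assms(2) by (simp add: power2_le_iff_abs_le)
qed

instance ell2 :: banach
proof
  fix X :: "nat \<Rightarrow> ell2" assume "Cauchy X"
  have "Cauchy (\<lambda>n. coord (X n) i)" for i
  proof (rule metric_CauchyI)
    fix e :: real assume "e > 0"
    with \<open>Cauchy X\<close> obtain M where M: "\<And>m n. m \<ge> M \<Longrightarrow> n \<ge> M \<Longrightarrow> dist (X m) (X n) < e"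
      unfolding Cauchy_def by metis
    have "dist (coord (X m) i) (coord (X n) i) < e" if "m \<ge> M" "n \<ge> M" for m n
      using M[OF that] abs_coord_le[of "X m - X n" i] by (simp add: dist_norm)
    then show "\<exists>M. \<forall>m\<ge>M. \<forall>n\<ge>M. dist (coord (X m) i) (coord (X n) i) < e" by blast
  qed
  then have "\<exists>l. (\<lambda>n. coord (X n) i) \<longlonglongrightarrow> l" for i
    using Cauchy_convergent convergent_def by blast
  then obtain c where c: "\<And>i. (\<lambda>n. coord (X n) i) \<longlonglongrightarrow> c i" by metis
  have near: "\<exists>M. \<forall>m\<ge>M. \<forall>N. (\<Sum>i<N. (coord (X m) i - c i)\<^sup>2) \<le> e\<^sup>2" if "e > 0" for e
  proof -
    from \<open>Cauchy X\<close> that obtain M where M: "\<And>m n. m \<ge> M \<Longrightarrow> n \<ge> M \<Longrightarrow> dist (X m) (X n) < e"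
      unfolding Cauchy_def by metis
    have "(\<Sum>i<N. (coord (X m) i - c i)\<^sup>2) \<le> e\<^sup>2" if m: "m \<ge> M" for m N
    proof (rule LIMSEQ_le_const2)
      show "(\<lambda>n. \<Sum>i<N. (coord (X m) i - coord (X n) i)\<^sup>2) \<longlonglongrightarrow> (\<Sum>i<N. (coord (X m) i - c i)\<^sup>2)"
        by (intro tendsto_intros c)
      have "(\<Sum>i<N. (coord (X m) i - coord (X n) i)\<^sup>2) \<le> e\<^sup>2" if "n \<ge> M" for n
      proof -
        have "(\<Sum>i<N. (coord (X m) i - coord (X n) i)\<^sup>2) \<le> (norm (X m - X n))\<^sup>2"
          using sum_coord_le[of "X m - X n" N] by simp
        also have "\<dots> \<le> e\<^sup>2" using M[OF m that] by (intro power_mono) (auto simp: dist_norm)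
        finally show ?thesis .
      qed
      then show "\<exists>n0. \<forall>n\<ge>n0. (\<Sum>i<N. (coord (X m) i - coord (X n) i)\<^sup>2) \<le> e\<^sup>2" by blast
    qed
    then show ?thesis by blast
  qed
  have ss: "square_summable c"
  proof -
    obtain M where M: "\<And>N. (\<Sum>i<N. (coord (X M) i - c i)\<^sup>2) \<le> 1\<^sup>2" using near[of 1] by auto
    have "square_summable (\<lambda>i. coord (X M) i - c i)"
      unfolding square_summable_def by (rule summableI_nonneg_bounded[OF _ M]) simp
    from square_summable_diff[OF square_summable_coord[of "X M"] this] show ?thesis by simp
  qed
  have "X \<longlonglongrightarrow> Abs_ell2 c"
  proof (rule metric_LIMSEQ_I)
    fix e :: real assume "e > 0"
    then obtain M where M: "\<And>m N. m \<ge> M \<Longrightarrow> (\<Sum>i<N. (coord (X m) i - c i)\<^sup>2) \<le> (e/2)\<^sup>2"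
      using near[of "e/2"] by auto
    have "norm (X m - Abs_ell2 c) \<le> e/2" if "m \<ge> M" for m
      using M[OF that] \<open>e > 0\<close> by (intro norm_ell2_le) (auto simp: coord_Abs_ell2[OF ss])
    then show "\<exists>M. \<forall>m\<ge>M. dist (X m) (Abs_ell2 c) < e"
      using \<open>e > 0\<close> by (intro exI[of _ M]) (fastforce simp: dist_norm)
  qed
  then show "convergent X" by (auto simp: convergent_def)
qed

lemma bounded_linear_coord: "bounded_linear (\<lambda>x. coord x i)"
  by (rule bounded_linear_intro[where K = 1]) (auto simp: abs_coord_le)

lift_definition coord_blinfun :: "nat \<Rightarrow> ell2 \<Rightarrow>\<^sub>L real" is "\<lambda>i x. coord x i"
  by (rule bounded_linear_coord)

lift_definition restrict_ell2 :: "nat set \<Rightarrow> ell2 \<Rightarrow> ell2" is "\<lambda>J a. ext0 J a"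
  by (simp add: square_summable_ext0)

lemma bounded_linear_restrict: "bounded_linear (restrict_ell2 J)"
proof (rule bounded_linear_intro[where K = 1])
  show "norm (restrict_ell2 J x) \<le> norm x * 1" for x
  proof -
    have "(\<Sum>i<N. (coord (restrict_ell2 J x) i)\<^sup>2) \<le> (norm x)\<^sup>2" for N
      using sum_coord_le[of x N]
      by (rule order_trans[rotated]) (auto intro!: sum_mono simp: restrict_ell2.rep_eq ext0_def)
    then show ?thesis by (simp add: norm_ell2_le)
  qed
qed (auto intro!: ell2_eqI simp: restrict_ell2.rep_eq ext0_def)

lift_definition restrict_blinfun :: "nat set \<Rightarrow> ell2 \<Rightarrow>\<^sub>L ell2" is restrict_ell2
  by (rule bounded_linear_restrict)

text \<open>The squared distance to the truncation is the tail of a convergent series.\<close>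

lemma tendsto_restrict_ell2: "(\<lambda>N. restrict_ell2 {..<N} x) \<longlonglongrightarrow> x"
proof -
  have sq: "(norm (x - restrict_ell2 {..<N} x))\<^sup>2 = (\<Sum>i. (coord x (i + N))\<^sup>2)" for N
  proof -
    have "(norm (x - restrict_ell2 {..<N} x))\<^sup>2 = (\<Sum>i. if i < N then 0 else (coord x i)\<^sup>2)"
      unfolding norm_ell2_squared by (intro suminf_cong) (auto simp: restrict_ell2.rep_eq ext0_def)
    also have "\<dots> = (\<Sum>i. if i + N < N then 0 else (coord x (i + N))\<^sup>2)"
    proof -
      have "summable (\<lambda>i. if i < N then 0 else (coord x i)\<^sup>2)"
        by (rule summable_comparison_test'[where N = 0 and g = "\<lambda>i. (coord x i)\<^sup>2"])
          (use square_summable_coord[of x] in \<open>auto simp: square_summable_def\<close>)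
      from suminf_split_initial_segment[OF this, of N] show ?thesis by simp
    qed
    finally show ?thesis by simp
  qed
  have "(\<lambda>N. \<Sum>i. (coord x (i + N))\<^sup>2) \<longlonglongrightarrow> 0"
    using square_summable_coord[of x] unfolding square_summable_def
    by (rule suminf_exist_split2)
  then have "(\<lambda>N. (norm (x - restrict_ell2 {..<N} x))\<^sup>2) \<longlonglongrightarrow> 0" by (simp add: sq)
  from tendsto_real_sqrt[OF this] have "(\<lambda>N. norm (x - restrict_ell2 {..<N} x)) \<longlonglongrightarrow> 0" by simp
  then have "(\<lambda>N. x - restrict_ell2 {..<N} x) \<longlonglongrightarrow> 0" by (rule tendsto_norm_zero_cancel)
  from tendsto_diff[OF tendsto_const[of x] this] show ?thesis by simp
qed

section \<open>The spaces \<open>Y(J)\<close>\<close>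

lemma nspace_simps [simp]: "pts (subsp X) = X" "nrm (subsp X) = norm"
  by (simp_all add: subsp_def)

lemma expansion_iff_tendsto: "expansion (subsp X) J v a x \<longleftrightarrow> psum J v a \<longlonglongrightarrow> x"
  unfolding expansion_def nspace_simps tendsto_norm_zero_iff by (rule Lim_null[symmetric])

lemma psum_supported: "(\<And>i. i \<notin> J \<Longrightarrow> a i = 0) \<Longrightarrow> psum J v a N = (\<Sum>i<N. a i *\<^sub>R v i)"
  unfolding psum_def by (rule sum.mono_neutral_left) auto

text \<open>
  The constants \<open>A\<close> and \<open>B\<close> do not depend on the index set.  This makes the restriction of
  coordinates from \<open>Y(J1)\<close> to \<open>Y(J2)\<close> bounded, which can fail for a conditional basis.
\<close>

locale sequence_spaces =
  fixes b :: "nat \<Rightarrow> 'f::{real_normed_vector, complete_space}" and A B :: real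
  assumes AB: "A > 0" "B > 0"
    and pts_Y: "\<And>J. pts (Y_space b J) = {c. (\<forall>i. i \<notin> J \<longrightarrow> c i = 0) \<and> square_summable c}"
    and norm_le_nrm: "\<And>J c. c \<in> pts (Y_space b J) \<Longrightarrow> norm (Abs_ell2 c) \<le> A * nrm (Y_space b J) c"
    and nrm_le_norm: "\<And>J c. c \<in> pts (Y_space b J) \<Longrightarrow> nrm (Y_space b J) c \<le> B * norm (Abs_ell2 c)"

text \<open>The partial sums of \<open>\<Sum> a\<^sub>i b\<^sub>i\<close> with square-summable \<open>a\<close> converge by the Hilbertian property, hence are
  pointwise bounded, hence uniformly bounded because the set where they are at most 1 is a barrel.
  This is the upper bound \<open>B\<close>.  The sum operator \<open>T\<close> from \<open>\<ell>\<^sup>2\<close> is injective by uniqueness of expansions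
  and onto by the Besselian property, so the open mapping theorem bounds \<open>norm x\<close> by a multiple of
  \<open>norm (T x)\<close>, which is at most the supremum of the norms of the partial sums.\<close>

lemma Y_spaces_isomorphic_to_ell2:
  fixes b :: "nat \<Rightarrow> 'f::{real_normed_vector, complete_space}"
  assumes basis: "schauder_basis whole UNIV b" and "besselian whole UNIV b" and "hilbertian whole UNIV b"
  obtains A B where "sequence_spaces b A B"
proof -
  define S where "S N x = (\<Sum>i<N. coord x i *\<^sub>R b i)" for N x
  have S_lin: "linear (S N)" for N
    by (rule linearI) (simp_all add: S_def scaleR_left_distrib sum.distrib scaleR_sum_right)
  have S_cont: "continuous_on UNIV (S N)" for N
    unfolding S_def by (intro continuous_intros bounded_linear.continuous_on[OF bounded_linear_coord])
  have conv_iff: "series_converges whole UNIV b a \<longleftrightarrow> square_summable a" for a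
    using assms(2,3) unfolding besselian_def hilbertian_def square_summable_def
    by (simp add: summable_on_UNIV_nonneg_real_iff) blast
  have psum_S: "psum UNIV b (coord x) = (\<lambda>N. S N x)" for x
    by (simp add: psum_def S_def fun_eq_iff)
  have S_conv: "convergent (\<lambda>N. S N x)" for x
    using conv_iff[of "coord x"] square_summable_coord[of x]
    by (auto simp: series_converges_def expansion_iff_tendsto psum_S convergent_def)
  define T where "T x = lim (\<lambda>N. S N x)" for x
  have T: "(\<lambda>N. S N x) \<longlonglongrightarrow> T x" for x
    using S_conv[of x] by (simp add: T_def convergent_LIMSEQ_iff)
  obtain e where e: "e > 0" "ball 0 e \<subseteq> {x. \<forall>N. norm (S N x) \<le> 1}"
  proof (rule barrel_is_neighbourhood_of_zero)
    have "{x. \<forall>N. norm (S N x) \<le> 1} = (\<Inter>N. S N -` cball 0 1)" by auto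
    moreover have "closed (S N -` cball 0 1)" "convex (S N -` cball 0 1)" for N
      using S_cont by (auto intro!: closed_vimage convex_linear_vimage S_lin)
    ultimately show "closed {x. \<forall>N. norm (S N x) \<le> 1}" "convex {x. \<forall>N. norm (S N x) \<le> 1}"
      by (auto intro: convex_INT)
    show "- x \<in> {x. \<forall>N. norm (S N x) \<le> 1}" if "x \<in> {x. \<forall>N. norm (S N x) \<le> 1}" for x
      using that by (simp add: linear_neg[OF S_lin])
    show "\<exists>r>0. r *\<^sub>R x \<in> {x. \<forall>N. norm (S N x) \<le> 1}" for x
    proof -
      obtain K where K: "K > 0" "\<And>N. norm (S N x) \<le> K"
        using convergent_imp_Bseq[OF S_conv] by (auto simp: Bseq_def)
      then show ?thesis
        by (intro exI[of _ "1 / K"]) (auto simp: linear_scale[OF S_lin] divide_le_eq)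
    qed
  qed
  define B where "B = 2 / e"
  have B: "B > 0" using e(1) by (simp add: B_def)
  have S_le: "norm (S N x) \<le> B * norm x" for N x
  proof (cases "x = 0")
    case False
    define r where "r = e / (2 * norm x)"
    have r: "r > 0" "norm (r *\<^sub>R x) < e" using e(1) False by (simp_all add: r_def)
    then have "norm (S N (r *\<^sub>R x)) \<le> 1" using subsetD[OF e(2), of "r *\<^sub>R x"] by simp
    then have "r * norm (S N x) \<le> 1" using r(1) by (simp add: linear_scale[OF S_lin])
    then have "norm (S N x) \<le> 1 / r" using r(1) by (simp add: field_simps)
    then show ?thesis by (simp add: B_def r_def)
  qed (simp add: linear_0[OF S_lin])
  have T_bl: "bounded_linear T"
  proof (rule bounded_linear_intro[where K = B])
    show "T (x + y) = T x + T y" for x y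
      using LIMSEQ_unique[OF T] tendsto_add[OF T T] by (simp add: linear_add[OF S_lin])
    show "T (r *\<^sub>R x) = r *\<^sub>R T x" for r x
      using LIMSEQ_unique[OF T] tendsto_scaleR[OF tendsto_const T] by (simp add: linear_scale[OF S_lin])
    show "norm (T x) \<le> norm x * B" for x
      using LIMSEQ_le_const2[OF tendsto_norm[OF T[of x]]] S_le[of _ x] by (auto simp: mult.commute)
  qed
  define TL where "TL = Blinfun T"
  have TL: "blinfun_apply TL x = T x" for x
    by (simp add: TL_def bounded_linear_Blinfun_apply[OF T_bl])
  have expansion_T: "expansion whole UNIV b (coord x) (T x)" for x
    using T[of x] by (simp add: expansion_iff_tendsto psum_S)
  have uniq: "a = a'" if "expansion whole UNIV b a y" "expansion whole UNIV b a' y" for a a' y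
    using basis that unfolding schauder_basis_def by auto
  have inj: "x = x'" if "T x = T x'" for x x'
    using uniq[OF expansion_T[of x], of "coord x'"] expansion_T[of x'] that by (simp add: coord_inject)
  have "surj (blinfun_apply TL)"
    unfolding surj_def
  proof
    fix y
    obtain a where a: "expansion whole UNIV b a y"
      using basis unfolding schauder_basis_def by force
    then have ss: "square_summable a"
      unfolding conv_iff[symmetric] series_converges_def by auto
    have "T (Abs_ell2 a) = y"
      using expansion_T[of "Abs_ell2 a"] a LIMSEQ_unique
      unfolding coord_Abs_ell2[OF ss] expansion_iff_tendsto by blast
    then show "\<exists>x. y = blinfun_apply TL x" by (metis TL)
  qed
  then obtain A where A: "onto_with_constant A TL" by (rule open_mapping)
  have T_ge: "norm x \<le> A * norm (T x)" for x
  proof -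
    obtain u where "T u = T x" "norm u \<le> A * norm (T x)"
      using A unfolding onto_with_constant_def TL by blast
    then show ?thesis using inj by metis
  qed
  have pts: "pts (Y_space b J) = {c. (\<forall>i. i \<notin> J \<longrightarrow> c i = 0) \<and> square_summable c}" for J
  proof -
    have "series_converges whole J b c \<longleftrightarrow> square_summable c" if "\<forall>i. i \<notin> J \<longrightarrow> c i = 0" for c
    proof -
      have "psum J b c = psum UNIV b c"
        using psum_supported[of J c b] that by (simp add: fun_eq_iff psum_def)
      then show ?thesis
        by (simp add: conv_iff[symmetric] series_converges_def expansion_def)
    qed
    then show ?thesis by (auto simp: Y_space_def)
  qed
  have nrm: "nrm (Y_space b J) c = (SUP N. norm (S N (Abs_ell2 c)))" if "c \<in> pts (Y_space b J)" for J c
  proof -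
    have c: "\<And>i. i \<notin> J \<Longrightarrow> c i = 0" "square_summable c" using that by (auto simp: pts)
    have "psum J b c N = S N (Abs_ell2 c)" for N
      using psum_supported[of J c b N] c by (simp add: S_def coord_Abs_ell2)
    then show ?thesis by (simp add: Y_space_def)
  qed
  have bdd: "bdd_above (range (\<lambda>N. norm (S N x)))" for x
    using S_le[of _ x] by (intro bdd_aboveI2)
  have "sequence_spaces b A B"
  proof
    show "A > 0" using A by (simp add: onto_with_constant_def)
    fix J c assume c: "c \<in> pts (Y_space b J)"
    have "norm (T x) \<le> (SUP N. norm (S N x))" for x
      using cSUP_upper[OF UNIV_I bdd[of x]] by (intro LIMSEQ_le_const2[OF tendsto_norm[OF T]]) auto
    then have "A * norm (T (Abs_ell2 c)) \<le> A * nrm (Y_space b J) c"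
      using A by (simp add: nrm[OF c] onto_with_constant_def)
    then show "norm (Abs_ell2 c) \<le> A * nrm (Y_space b J) c" using T_ge order_trans by blast
    show "nrm (Y_space b J) c \<le> B * norm (Abs_ell2 c)"
      unfolding nrm[OF c] by (rule cSUP_least) (auto intro: S_le)
  qed (fact B pts)+
  then show ?thesis by (rule that)
qed

section \<open>The rank theorem\<close>

context sequence_spaces
begin

lemma Abs_ell2_add: "u \<in> pts (Y_space b J) \<Longrightarrow> v \<in> pts (Y_space b J) \<Longrightarrow>
    Abs_ell2 (u + v) = Abs_ell2 u + Abs_ell2 v"
  and Abs_ell2_diff: "u \<in> pts (Y_space b J) \<Longrightarrow> v \<in> pts (Y_space b J) \<Longrightarrow>
    Abs_ell2 (u - v) = Abs_ell2 u - Abs_ell2 v"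
  and Abs_ell2_scale: "u \<in> pts (Y_space b J) \<Longrightarrow> Abs_ell2 (r *\<^sub>R u) = r *\<^sub>R Abs_ell2 u"
  by (auto intro!: ell2_eqI simp: pts_Y plus_fun_def fun_diff_def scaleR_fun_def coord_Abs_ell2
      square_summable_add square_summable_diff square_summable_scale)

lemma Y_diff: "u \<in> pts (Y_space b J) \<Longrightarrow> v \<in> pts (Y_space b J) \<Longrightarrow> u - v \<in> pts (Y_space b J)"
  by (auto simp: pts_Y fun_diff_def square_summable_diff)

lemma C1_on_Y_space:
  assumes k: "C1_with UNIV k k'"
  shows "C1_on (Y_space b J) whole (pts (Y_space b J)) (\<lambda>c. (k :: ell2 \<Rightarrow> real) (Abs_ell2 c))"
proof -
  let ?Y = "Y_space b J"
  define D where "D c d = k' (Abs_ell2 c) (Abs_ell2 d)" for c d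
  have norm_D_le: "norm (blinfun_apply L (Abs_ell2 d)) \<le> norm L * A * nrm ?Y d"
    if "d \<in> pts ?Y" for L :: "ell2 \<Rightarrow>\<^sub>L real" and d
  proof -
    have "norm (blinfun_apply L (Abs_ell2 d)) \<le> norm L * norm (Abs_ell2 d)" by (rule norm_blinfun)
    also have "\<dots> \<le> norm L * (A * nrm ?Y d)" by (intro mult_left_mono norm_le_nrm that) simp
    finally show ?thesis by (simp add: mult.assoc)
  qed
  have "has_frechet_derivative_on ?Y whole (pts ?Y) (\<lambda>c. k (Abs_ell2 c)) (D c) c" if c: "c \<in> pts ?Y" for c
    unfolding has_frechet_derivative_on_def nspace_simps
  proof (intro conjI allI impI)
    have "linear_over (pts ?Y) (D c)"
      by (auto simp: linear_over_def D_def Abs_ell2_add Abs_ell2_scale blinfun.add_right blinfun.scaleR_right)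
    moreover have "\<exists>K. \<forall>u\<in>pts ?Y. norm (D c u) \<le> K * nrm ?Y u"
      unfolding D_def using norm_D_le by blast
    ultimately show "bounded_linear_between ?Y whole (D c)"
      by (simp add: bounded_linear_between_def)
    fix e :: real assume "e > 0"
    then have "e / A > 0" using AB by simp
    moreover have "(k has_derivative k' (Abs_ell2 c)) (at (Abs_ell2 c))" using k by (simp add: C1_with_def)
    ultimately obtain d where d: "d > 0" "\<And>y. norm (y - Abs_ell2 c) < d \<Longrightarrow>
        norm (k y - k (Abs_ell2 c) - k' (Abs_ell2 c) (y - Abs_ell2 c)) \<le> e / A * norm (y - Abs_ell2 c)"
      unfolding has_derivative_at_alt by blast
    have "norm (k (Abs_ell2 y) - k (Abs_ell2 c) - D c (y - c)) \<le> e * nrm ?Y (y - c)"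
      if y: "y \<in> pts ?Y" and near: "nrm ?Y (y - c) < d / A" for y
    proof -
      have *: "norm (Abs_ell2 y - Abs_ell2 c) \<le> A * nrm ?Y (y - c)"
        using norm_le_nrm[OF Y_diff[OF y c]] by (simp add: Abs_ell2_diff[OF y c])
      also have "\<dots> < d" using near AB by (simp add: field_simps)
      finally have "norm (k (Abs_ell2 y) - k (Abs_ell2 c) - D c (y - c)) \<le> e / A * norm (Abs_ell2 y - Abs_ell2 c)"
        using d(2) by (simp add: D_def Abs_ell2_diff[OF y c])
      also have "\<dots> \<le> e / A * (A * nrm ?Y (y - c))"
        using * \<open>e / A > 0\<close> by (intro mult_left_mono) auto
      finally show ?thesis using AB by simp
    qed
    then show "\<exists>d>0. \<forall>y\<in>pts ?Y. nrm ?Y (y - c) < d \<longrightarrow>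
        norm (k (Abs_ell2 y) - k (Abs_ell2 c) - D c (y - c)) \<le> e * nrm ?Y (y - c)"
      using d(1) AB by (intro exI[of _ "d / A"]) auto
  qed
  moreover have "\<exists>d>0. \<forall>y\<in>pts ?Y. nrm ?Y (y - c) < d \<longrightarrow> op_norm ?Y whole (D y - D c) < e"
    if c: "c \<in> pts ?Y" and "e > 0" for c e
  proof -
    have "isCont k' (Abs_ell2 c)" using k by (simp add: C1_with_def continuous_on_eq_continuous_at)
    then obtain d where d: "d > 0"
      "\<And>y. dist y (Abs_ell2 c) < d \<Longrightarrow> dist (k' y) (k' (Abs_ell2 c)) < e / (2 * A)"
      unfolding continuous_at_eps_delta using \<open>e > 0\<close> AB
      by (metis divide_pos_pos mult_pos_pos zero_less_numeral)
    have "op_norm ?Y whole (D y - D c) < e" if y: "y \<in> pts ?Y" and near: "nrm ?Y (y - c) < d / A" for y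
    proof -
      have "norm (Abs_ell2 y - Abs_ell2 c) \<le> A * nrm ?Y (y - c)"
        using norm_le_nrm[OF Y_diff[OF y c]] by (simp add: Abs_ell2_diff[OF y c])
      also have "\<dots> < d" using near AB by (simp add: field_simps)
      finally have k'_near: "norm (k' (Abs_ell2 y) - k' (Abs_ell2 c)) * A < e / 2"
        using d(2)[of "Abs_ell2 y"] AB by (simp add: dist_norm field_simps)
      have zero: "0 \<in> pts ?Y" by (simp add: pts_Y square_summable_def)
      have "Abs_ell2 0 = 0"
        by (rule ell2_eqI) (simp add: coord_Abs_ell2 square_summable_def zero_fun_def)
      then have "nrm ?Y 0 \<le> 1" using nrm_le_norm[OF zero] by simp
      then have "{u \<in> pts ?Y. nrm ?Y u \<le> 1} \<noteq> {}" using zero by blast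
      then have "op_norm ?Y whole (D y - D c) \<le> e / 2"
        unfolding op_norm_def nspace_simps
      proof (rule cSUP_least)
        fix u assume "u \<in> {u \<in> pts ?Y. nrm ?Y u \<le> 1}"
        then have u: "u \<in> pts ?Y" "nrm ?Y u \<le> 1" by auto
        have "norm ((D y - D c) u) \<le> norm (k' (Abs_ell2 y) - k' (Abs_ell2 c)) * A * nrm ?Y u"
          using norm_D_le[OF u(1), of "k' (Abs_ell2 y) - k' (Abs_ell2 c)"]
          by (simp add: D_def blinfun.diff_left)
        also have "\<dots> \<le> norm (k' (Abs_ell2 y) - k' (Abs_ell2 c)) * A * 1"
          using u(2) AB by (intro mult_left_mono) auto
        finally show "norm ((D y - D c) u) \<le> e / 2" using k'_near by simp
      qed
      then show ?thesis using \<open>e > 0\<close> by simp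
    qed
    then show ?thesis using d(1) AB by (intro exI[of _ "d / A"]) auto
  qed
  ultimately show ?thesis unfolding C1_on_def by (auto intro!: exI[of _ D])
qed

text \<open>The isomorphism of \<open>Y(J)\<close> with a subspace of \<open>\<ell>\<^sup>2\<close> carries derivatives to derivatives.  The bound
  \<open>B\<close> enters because \<open>op_norm\<close> is a supremum of reals, which controls the values only once they are
  known to be bounded.\<close>

lemma C1_with_ell2_of_C1_on:
  assumes "open U" and F: "C1_on whole (Y_space b J) U F"
  obtains F' where "C1_with U (\<lambda>x::'e::real_normed_vector. Abs_ell2 (F x)) F'"
proof -
  let ?Y = "Y_space b J"
  obtain D where FY: "F ` U \<subseteq> pts ?Y"
    and D: "\<And>x. x \<in> U \<Longrightarrow> has_frechet_derivative_on whole ?Y U F (D x) x"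
    and D_cont: "\<And>x e. x \<in> U \<Longrightarrow> e > 0 \<Longrightarrow>
      \<exists>d>0. \<forall>y\<in>U. norm (y - x) < d \<longrightarrow> op_norm whole ?Y (D y - D x) < e"
    using F unfolding C1_on_def nspace_simps by blast
  have D_pts: "D x u \<in> pts ?Y" and D_lin: "linear_over UNIV (D x)"
    and D_bd: "\<exists>K. \<forall>u. nrm ?Y (D x u) \<le> K * norm u" if "x \<in> U" for x u
    using D[OF that] by (auto simp: has_frechet_derivative_on_def bounded_linear_between_def)
  define F' where "F' x = Blinfun (\<lambda>u. Abs_ell2 (D x u))" for x
  have F': "F' x u = Abs_ell2 (D x u)" if x: "x \<in> U" for x u
  proof -
    obtain K where K: "\<And>u. nrm ?Y (D x u) \<le> K * norm u" using D_bd[OF x] by blast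
    have "bounded_linear (\<lambda>u. Abs_ell2 (D x u))"
    proof (rule bounded_linear_intro)
      show "norm (Abs_ell2 (D x u)) \<le> norm u * (A * K)" for u
        using order_trans[OF norm_le_nrm[OF D_pts[OF x]] mult_left_mono[OF K]] AB
        by (simp add: mult_ac)
    qed (use D_lin[OF x] Abs_ell2_add[OF D_pts[OF x] D_pts[OF x]] Abs_ell2_scale[OF D_pts[OF x]]
        in \<open>simp_all add: linear_over_def\<close>)
    then show ?thesis by (simp add: F'_def bounded_linear_Blinfun_apply)
  qed
  have "((\<lambda>x. Abs_ell2 (F x)) has_derivative F' x) (at x)" if x: "x \<in> U" for x
    unfolding has_derivative_at_alt
  proof (intro conjI allI impI)
    show "bounded_linear (blinfun_apply (F' x))" by (rule blinfun.bounded_linear_right)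
    fix e :: real assume "e > 0"
    then have "e / A > 0" using AB by simp
    then obtain d1 where d1: "d1 > 0" "\<And>y. y \<in> U \<Longrightarrow> norm (y - x) < d1 \<Longrightarrow>
        nrm ?Y (F y - F x - D x (y - x)) \<le> e / A * norm (y - x)"
      using D[OF x] unfolding has_frechet_derivative_on_def nspace_simps by blast
    obtain d2 where d2: "d2 > 0" "ball x d2 \<subseteq> U" using \<open>open U\<close> x openE by blast
    have "norm (Abs_ell2 (F y) - Abs_ell2 (F x) - F' x (y - x)) \<le> e * norm (y - x)"
      if "norm (y - x) < min d1 d2" for y
    proof -
      have y: "y \<in> U" using that d2 by (auto simp: dist_norm norm_minus_commute)
      have pts: "F y \<in> pts ?Y" "F x \<in> pts ?Y" "D x (y - x) \<in> pts ?Y" using FY x y D_pts by auto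
      have "norm (Abs_ell2 (F y) - Abs_ell2 (F x) - F' x (y - x)) = norm (Abs_ell2 (F y - F x - D x (y - x)))"
        by (simp add: F'[OF x] Abs_ell2_diff[OF Y_diff[OF pts(1,2)] pts(3)] Abs_ell2_diff[OF pts(1,2)])
      also have "\<dots> \<le> A * nrm ?Y (F y - F x - D x (y - x))"
        by (intro norm_le_nrm Y_diff pts)
      also have "\<dots> \<le> A * (e / A * norm (y - x))"
        using d1(2)[OF y] that AB by (intro mult_left_mono) auto
      finally show ?thesis using AB by simp
    qed
    then show "\<exists>d>0. \<forall>y. norm (y - x) < d \<longrightarrow>
        norm (Abs_ell2 (F y) - Abs_ell2 (F x) - F' x (y - x)) \<le> e * norm (y - x)"
      using d1(1) d2(1) by (intro exI[of _ "min d1 d2"]) auto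
  qed
  moreover have norm_F'_diff: "norm (F' y - F' x) \<le> A * op_norm whole ?Y (D y - D x)"
    if x: "x \<in> U" and y: "y \<in> U" for x y
  proof -
    have F'_diff: "(F' y - F' x) u = Abs_ell2 ((D y - D x) u)"
      and D_diff: "(D y - D x) u \<in> pts ?Y" for u
      by (simp_all add: blinfun.diff_left F' x y Abs_ell2_diff[OF D_pts[OF y] D_pts[OF x]] Y_diff D_pts)
    have "nrm ?Y ((D y - D x) u) \<le> B * norm (F' y - F' x)" if "norm u \<le> 1" for u
    proof -
      have "norm ((F' y - F' x) u) \<le> norm (F' y - F' x) * norm u" by (rule norm_blinfun)
      also have "\<dots> \<le> norm (F' y - F' x)" using that by (simp add: mult_left_le)
      finally show ?thesis
        using order_trans[OF nrm_le_norm[OF D_diff] mult_left_mono] AB by (simp add: F'_diff)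
    qed
    then have "bdd_above ((\<lambda>u. nrm ?Y ((D y - D x) u)) ` {u \<in> UNIV. norm u \<le> 1})"
      by (intro bdd_aboveI2) auto
    then have le_op: "nrm ?Y ((D y - D x) u) \<le> op_norm whole ?Y (D y - D x)" if "norm u \<le> 1" for u
      unfolding op_norm_def nspace_simps by (rule cSUP_upper[rotated]) (use that in simp)
    have unit: "norm ((F' y - F' x) u) \<le> A * op_norm whole ?Y (D y - D x)" if "norm u \<le> 1" for u
      unfolding F'_diff
      by (rule order_trans[OF norm_le_nrm[OF D_diff] mult_left_mono[OF le_op[OF that]]]) (use AB in simp)
    show ?thesis
    proof (rule norm_blinfun_bound)
      show "0 \<le> A * op_norm whole ?Y (D y - D x)" using unit[of 0] by simp
      fix u
      show "norm ((F' y - F' x) u) \<le> A * op_norm whole ?Y (D y - D x) * norm u"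
      proof (cases "u = 0")
        case False
        have "norm ((F' y - F' x) (u /\<^sub>R norm u)) \<le> A * op_norm whole ?Y (D y - D x)"
          using False by (intro unit) simp
        then show ?thesis using False by (simp add: blinfun.scaleR_right field_simps)
      qed simp
    qed
  qed
  moreover have "continuous_on U F'"
    unfolding continuous_on_iff
  proof (intro ballI allI impI)
    fix x and e :: real assume x: "x \<in> U" and "e > 0"
    then have "e / A > 0" using AB by simp
    from D_cont[OF x this] obtain d where d: "d > 0"
      "\<And>y. y \<in> U \<Longrightarrow> norm (y - x) < d \<Longrightarrow> op_norm whole ?Y (D y - D x) < e / A" by blast
    have "norm (F' y - F' x) < e" if y: "y \<in> U" and near: "norm (y - x) < d" for y
    proof -
      have "A * op_norm whole ?Y (D y - D x) < e"
        using d(2)[OF y near] AB by (simp add: field_simps)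
      then show ?thesis using norm_F'_diff[OF x y] by linarith
    qed
    then show "\<exists>d>0. \<forall>y\<in>U. dist y x < d \<longrightarrow> dist (F' y) (F' x) < e"
      using d(1) by (auto simp: dist_norm)
  qed
  ultimately show ?thesis by (intro that[of F']) (simp add: C1_with_def)
qed

text \<open>Truncations of an element of \<open>Y(J)\<close> are finite combinations of unit vectors and converge to it in the
  norm of \<open>Y(J)\<close>, because they do so in \<open>\<ell>\<^sup>2\<close>.\<close>

lemma closed_subspace_with_unit_vectors_is_whole:
  assumes closed: "closed_in_nspace (Y_space b J) S"
    and sub: "\<And>r u. u \<in> S \<Longrightarrow> r *\<^sub>R u \<in> S" "\<And>u v. u \<in> S \<Longrightarrow> v \<in> S \<Longrightarrow> u + v \<in> S" "0 \<in> S"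
    and unit: "\<And>i. i \<in> J \<Longrightarrow> (\<lambda>j. if j = i then 1 else 0) \<in> S"
  shows "S = pts (Y_space b J)"
proof
  let ?Y = "Y_space b J"
  show "S \<subseteq> pts ?Y" using closed by (simp add: closed_in_nspace_def)
  show "pts ?Y \<subseteq> S"
  proof
    fix y assume y: "y \<in> pts ?Y"
    then have y0: "\<And>i. i \<notin> J \<Longrightarrow> y i = 0" and ss: "square_summable y" by (auto simp: pts_Y)
    have trunc: "ext0 {..<N} y \<in> S" for N
    proof (induction N)
      case 0
      have "ext0 {..<0} y = 0" by (simp add: ext0_def fun_eq_iff)
      then show ?case using sub(3) by metis
    next
      case (Suc N)
      have "ext0 {..<Suc N} y = ext0 {..<N} y + y N *\<^sub>R (\<lambda>j. if j = N then 1 else 0)"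
        by (auto simp: ext0_def fun_eq_iff scaleR_fun_def less_Suc_eq)
      moreover have "y N *\<^sub>R (\<lambda>j. if j = N then 1 else 0) \<in> S"
      proof (cases "N \<in> J")
        case False
        then have "y N *\<^sub>R (\<lambda>j. if j = N then 1 else 0 :: real) = 0"
          by (simp add: y0 scaleR_fun_def fun_eq_iff)
        then show ?thesis using sub(3) by metis
      qed (intro sub unit)
      ultimately show ?case using Suc.IH sub(2) by metis
    qed
    have "\<exists>s\<in>S. nrm ?Y (s - y) < e" if "e > 0" for e
    proof -
      have "(\<lambda>N. restrict_ell2 {..<N} (Abs_ell2 y)) \<longlonglongrightarrow> Abs_ell2 y" by (rule tendsto_restrict_ell2)
      then obtain N where N: "norm (restrict_ell2 {..<N} (Abs_ell2 y) - Abs_ell2 y) < e / B"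
        using \<open>e > 0\<close> AB unfolding LIMSEQ_iff by (meson divide_pos_pos order_refl)
      have t: "ext0 {..<N} y \<in> pts ?Y" using trunc \<open>S \<subseteq> pts ?Y\<close> by blast
      have "restrict_ell2 {..<N} (Abs_ell2 y) = Abs_ell2 (ext0 {..<N} y)"
        by (rule ell2_eqI) (simp add: restrict_ell2.rep_eq coord_Abs_ell2 ss square_summable_ext0)
      then have "nrm ?Y (ext0 {..<N} y - y) \<le> B * norm (restrict_ell2 {..<N} (Abs_ell2 y) - Abs_ell2 y)"
        using nrm_le_norm[OF Y_diff[OF t y]] by (simp add: Abs_ell2_diff[OF t y])
      also have "\<dots> < e" using N AB by (simp add: field_simps)
      finally show ?thesis using trunc by blast
    qed
    then show "y \<in> S" using closed y unfolding closed_in_nspace_def by blast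
  qed
qed

end

lemma biorth_basis_vector:
  assumes basis: "schauder_basis X J v" and "j \<in> J" and zero: "nrm X 0 = 0"
  shows "biorth X J v i (v j) = (if i = j then 1 else 0)"
proof -
  let ?e = "\<lambda>i. if i = j then 1 else 0 :: real"
  have vj: "v j \<in> pts X" using basis \<open>j \<in> J\<close> by (auto simp: schauder_basis_def)
  have "psum J v ?e N = v j" if "N > j" for N
    unfolding psum_def using that \<open>j \<in> J\<close> by (simp add: if_distrib[of "\<lambda>r. r *\<^sub>R _"] cong: if_cong)
  then have "expansion X J v ?e (v j)"
    unfolding expansion_def
    by (intro tendsto_eventually eventually_sequentiallyI[of "Suc j"]) (simp add: zero)
  then have P: "(\<forall>i. i \<notin> J \<longrightarrow> ?e i = 0) \<and> expansion X J v ?e (v j)" using \<open>j \<in> J\<close> by auto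
  have "(THE a. (\<forall>i. i \<notin> J \<longrightarrow> a i = 0) \<and> expansion X J v a (v j)) = ?e"
    using basis vj P unfolding schauder_basis_def by (intro the1_equality) auto
  then show ?thesis using vj by (simp add: biorth_def)
qed

text \<open>A vector annihilated by a basis of functionals is annihilated by every functional that has an
  expansion, as evaluation at that vector is continuous.\<close>

lemma basis_kernel_subset:
  fixes v :: "nat \<Rightarrow> 'e::real_normed_vector \<Rightarrow>\<^sub>L real"
  assumes basis: "schauder_basis (subsp X) J v" and "\<xi> \<in> X"
    and "\<And>i. i \<in> J \<Longrightarrow> v i u = 0"
  shows "\<xi> u = 0"
proof -
  obtain a where "expansion (subsp X) J v a \<xi>"
    using basis \<open>\<xi> \<in> X\<close> unfolding schauder_basis_def nspace_simps by metis
  then have "psum J v a \<longlonglongrightarrow> \<xi>" by (simp add: expansion_iff_tendsto)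
  then have "(\<lambda>N. psum J v a N u) \<longlonglongrightarrow> \<xi> u"
    by (intro bounded_bilinear.tendsto[OF bounded_bilinear_blinfun_apply] tendsto_const)
  moreover have "psum J v a N u = 0" for N
    using assms(3) by (simp add: psum_def blinfun.sum_left blinfun.scaleR_left)
  ultimately show ?thesis by (simp add: LIMSEQ_const_iff)
qed

theorem proposition5p3:
  fixes b :: "nat \<Rightarrow> 'f::{real_inner, complete_space}"
    and f :: "nat \<Rightarrow> 'e::banach \<Rightarrow> real"
    and U V :: "'e set"
    and x0 :: 'e
    and J1 J2 :: "nat set"
  assumes "schauder_basis whole UNIV b"
    and "besselian whole UNIV b"
    and "hilbertian whole UNIV b"
    and "open U"
    and "x0 \<in> U"
    and "C1_on whole (Y_space b J1) U (\<lambda>x. ext0 J1 (\<lambda>i. f i x))"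
    and "V \<subseteq> U"
    and "x0 \<in> interior V"
    and "CRC_plus b f J1 J2 x0 V"
  shows "\<exists>h :: nat \<Rightarrow> (nat \<Rightarrow> real) \<Rightarrow> real.
           (\<forall>l\<in>J1 - J2. C1_on (Y_space b J2) whole (pts (Y_space b J2)) (h l)) \<and>
           (\<exists>W. open W \<and> x0 \<in> W \<and> W \<subseteq> U \<and>
             (\<forall>l\<in>J1 - J2. \<forall>x\<in>W. f l x = h l (ext0 J2 (\<lambda>i. f i x))))"
proof -
  obtain A B where "sequence_spaces b A B"
    using Y_spaces_isomorphic_to_ell2[OF assms(1-3)] .
  then interpret sequence_spaces b A B .
  let ?F = "\<lambda>x. ext0 J1 (\<lambda>i. f i x)"
  let ?X = "\<lambda>x. subsp (cspan_D f J1 x)"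
  let ?S = "range (\<lambda>e. ext0 J2 (\<lambda>i. blinfun_apply (Dcomp f x0 i) e))"
  have J: "J2 \<subseteq> J1"
    and basis: "\<And>x. x \<in> V \<Longrightarrow> schauder_basis (?X x) J2 (Dcomp f x)"
    and closed: "closed_in_nspace (Y_space b J2) ?S"
    and dual: "\<And>i. i \<in> J2 \<Longrightarrow> \<exists>e. \<forall>\<xi>\<in>cspan_D f J1 x0. biorth (?X x0) J2 (Dcomp f x0) i \<xi> = \<xi> e"
    using \<open>CRC_plus b f J1 J2 x0 V\<close> unfolding CRC_plus_def by blast+
  obtain F' where F': "C1_with U (\<lambda>x. Abs_ell2 (?F x)) F'"
    using C1_with_ell2_of_C1_on[OF \<open>open U\<close> assms(6)] .
  have ss: "square_summable (?F x)" if "x \<in> U" for x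
    using assms(6) that by (auto simp: C1_on_def pts_Y)
  have C1_f: "C1_with U (f i) (\<lambda>x. coord_blinfun i o\<^sub>L F' x)" if "i \<in> J1" for i
    unfolding C1_with_def
  proof (intro conjI ballI)
    fix x assume x: "x \<in> U"
    have "((\<lambda>x. coord_blinfun i (Abs_ell2 (?F x))) has_derivative (\<lambda>u. coord_blinfun i (F' x u))) (at x)"
      using F' x by (intro bounded_linear.has_derivative[OF blinfun.bounded_linear_right]) (simp add: C1_with_def)
    moreover have "coord_blinfun i (Abs_ell2 (?F y)) = f i y" if "y \<in> U" for y
      unfolding coord_blinfun.rep_eq coord_Abs_ell2[OF ss[OF that]] using \<open>i \<in> J1\<close> by (simp add: ext0_def)
    ultimately have "(f i has_derivative (\<lambda>u. coord_blinfun i (F' x u))) (at x)"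
      using has_derivative_transform_within_open[OF _ \<open>open U\<close> x] by blast
    then show "(f i has_derivative (coord_blinfun i o\<^sub>L F' x)) (at x)"
      by (rule has_derivative_eq_rhs) (simp add: fun_eq_iff)
  next
    show "continuous_on U (\<lambda>x. coord_blinfun i o\<^sub>L F' x)"
      using F' by (intro bounded_bilinear.continuous_on[OF bounded_bilinear_blinfun_compose] continuous_on_const)
        (simp add: C1_with_def)
  qed
  have Dcomp: "Dcomp f x i = coord_blinfun i o\<^sub>L F' x" if "x \<in> U" "i \<in> J1" for x i
  proof -
    have "(f i has_derivative (coord_blinfun i o\<^sub>L F' x)) (at x)"
      using C1_f[OF that(2)] that(1) by (simp add: C1_with_def)
    from frechet_derivative_at[OF this] show ?thesis
      unfolding Dcomp_def by (metis blinfun_apply_inverse)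
  qed
  have "x0 \<in> V" using \<open>x0 \<in> interior V\<close> interior_subset by blast
  have cspan: "Dcomp f x i \<in> cspan_D f J1 x" if "i \<in> J1" for x i
    unfolding cspan_D_def by (rule subsetD[OF closure_subset span_base[OF imageI[OF that]]])
  \<comment> \<open>The functional biorthogonal to \<open>Df\<^sub>i(x0)\<close> is evaluation at some \<open>e\<close>, and this \<open>e\<close> is mapped to the \<open>i\<close>-th unit vector.\<close>
  have S: "?S = pts (Y_space b J2)"
  proof (rule closed_subspace_with_unit_vectors_is_whole[OF closed])
    show "(\<lambda>j. if j = i then 1 else 0) \<in> ?S" if i: "i \<in> J2" for i
    proof -
      obtain e where e: "\<And>\<xi>. \<xi> \<in> cspan_D f J1 x0 \<Longrightarrow> biorth (?X x0) J2 (Dcomp f x0) i \<xi> = \<xi> e"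
        using dual[OF i] by blast
      have "Dcomp f x0 j e = (if j = i then 1 else 0)" if "j \<in> J2" for j
        using biorth_basis_vector[OF basis[OF \<open>x0 \<in> V\<close>] that, of i] e[OF cspan] J that by auto
      then have "(\<lambda>j. if j = i then 1 else 0) = ext0 J2 (\<lambda>j. Dcomp f x0 j e)"
        using i by (auto simp: ext0_def fun_eq_iff)
      then show ?thesis by blast
    qed
    have ext0_add: "ext0 J2 (\<lambda>i. Dcomp f x0 i d) + ext0 J2 (\<lambda>i. Dcomp f x0 i e) = ext0 J2 (\<lambda>i. Dcomp f x0 i (d + e))"
      and ext0_scale: "r *\<^sub>R ext0 J2 (\<lambda>i. Dcomp f x0 i d) = ext0 J2 (\<lambda>i. Dcomp f x0 i (r *\<^sub>R d))"
      and ext0_0: "0 = ext0 J2 (\<lambda>i. Dcomp f x0 i 0)" for d e r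
      by (auto simp: ext0_def fun_eq_iff scaleR_fun_def blinfun.add_right blinfun.scaleR_right)
    show "r *\<^sub>R u \<in> ?S" if "u \<in> ?S" for r u using that ext0_scale by auto
    show "u + v \<in> ?S" if "u \<in> ?S" "v \<in> ?S" for u v using that ext0_add by auto
    show "0 \<in> ?S" using ext0_0 by blast
  qed
  define g where "g x = restrict_blinfun J2 (Abs_ell2 (?F x))" for x
  define g' where "g' x = restrict_blinfun J2 o\<^sub>L F' x" for x
  have coord_g': "coord (g' x u) i = (if i \<in> J2 then Dcomp f x i u else 0)" if "x \<in> U" for x u i
    using Dcomp[OF that, of i] J
    by (auto simp: g'_def restrict_blinfun.rep_eq restrict_ell2.rep_eq ext0_def coord_blinfun.rep_eq)
  have V_U: "interior V \<subseteq> U" using \<open>V \<subseteq> U\<close> interior_subset by blast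
  have "C1_with U g g'"
    unfolding C1_with_def
  proof (intro conjI ballI)
    fix x assume x: "x \<in> U"
    have "(g has_derivative (\<lambda>u. restrict_blinfun J2 (F' x u))) (at x)"
      unfolding g_def using F' x
      by (intro bounded_linear.has_derivative[OF blinfun.bounded_linear_right]) (simp add: C1_with_def)
    then show "(g has_derivative g' x) (at x)"
      by (rule has_derivative_eq_rhs) (simp add: fun_eq_iff g'_def)
  next
    show "continuous_on U g'"
      unfolding g'_def using F'
      by (intro bounded_bilinear.continuous_on[OF bounded_bilinear_blinfun_compose] continuous_on_const)
        (simp add: C1_with_def)
  qed
  then have g: "C1_with (interior V) g g'" using V_U by (rule C1_with_subset)
  obtain W where W: "open W" "x0 \<in> W" "W \<subseteq> interior V" and
    dep: "\<forall>(\<phi> :: 'e \<Rightarrow> real) \<phi>'. C1_with (interior V) \<phi> \<phi>' \<longrightarrow>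
      (\<forall>x\<in>interior V. \<forall>u. g' x u = 0 \<longrightarrow> \<phi>' x u = 0) \<longrightarrow>
      (\<exists>h h'. C1_with UNIV h h' \<and> (\<forall>x\<in>W. \<phi> x = h (g x)))"
  proof -
    have "restrict_blinfun J2 (restrict_blinfun J2 y) = restrict_blinfun J2 y" for y
      by (rule ell2_eqI) (simp add: restrict_blinfun.rep_eq restrict_ell2.rep_eq ext0_def)
    moreover have "restrict_blinfun J2 (g' x u) = g' x u" if "x \<in> interior V" for x u
      by (rule ell2_eqI) (simp add: g'_def restrict_blinfun.rep_eq restrict_ell2.rep_eq ext0_def)
    moreover have "\<exists>u. g' x0 u = restrict_blinfun J2 y" for y
    proof -
      have "ext0 J2 (coord y) \<in> ?S"
        unfolding S pts_Y using square_summable_ext0[OF square_summable_coord[of y]] by (auto simp: ext0_def)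
      then obtain u where u: "ext0 J2 (coord y) = ext0 J2 (\<lambda>i. Dcomp f x0 i u)" by blast
      have "coord (g' x0 u) i = coord (restrict_blinfun J2 y) i" for i
        using fun_cong[OF u, of i] \<open>x0 \<in> U\<close>
        by (simp add: coord_g' restrict_blinfun.rep_eq restrict_ell2.rep_eq ext0_def)
      then show ?thesis using ell2_eqI by blast
    qed
    ultimately show ?thesis
      using functional_dependence[OF open_interior \<open>x0 \<in> interior V\<close> g, of "restrict_blinfun J2"] that
      by blast
  qed
  have "\<exists>k k'. C1_with UNIV k k' \<and> (\<forall>x\<in>W. f l x = k (g x))" if "l \<in> J1" for l
  proof (rule dep[rule_format])
    show "C1_with (interior V) (f l) (\<lambda>x. coord_blinfun l o\<^sub>L F' x)"
      using C1_f[OF that] V_U by (rule C1_with_subset)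
    fix x u assume x: "x \<in> interior V" and u: "g' x u = 0"
    have "x \<in> U" "x \<in> V" using x V_U interior_subset by auto
    have "Dcomp f x i u = 0" if "i \<in> J2" for i
      using coord_g'[OF \<open>x \<in> U\<close>, of u i] u that by simp
    from basis_kernel_subset[OF basis[OF \<open>x \<in> V\<close>] cspan[OF \<open>l \<in> J1\<close>] this]
    show "(coord_blinfun l o\<^sub>L F' x) u = 0" using Dcomp[OF \<open>x \<in> U\<close> \<open>l \<in> J1\<close>] by simp
  qed
  then obtain k k' where k: "\<And>l. l \<in> J1 \<Longrightarrow> C1_with UNIV (k l) (k' l)"
    and f_eq: "\<And>l x. l \<in> J1 \<Longrightarrow> x \<in> W \<Longrightarrow> f l x = k l (g x)" by metis
  have "g x = Abs_ell2 (ext0 J2 (\<lambda>i. f i x))" if "x \<in> U" for x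
  proof -
    have *: "ext0 J2 (\<lambda>i. f i x) = ext0 J2 (?F x)" using J by (auto simp: ext0_def fun_eq_iff)
    show ?thesis
      unfolding * g_def
      by (rule ell2_eqI) (simp add: restrict_blinfun.rep_eq restrict_ell2.rep_eq coord_Abs_ell2 ss
          square_summable_ext0 that)
  qed
  then have "\<forall>l\<in>J1 - J2. \<forall>x\<in>W. f l x = k l (Abs_ell2 (ext0 J2 (\<lambda>i. f i x)))"
    using f_eq W(3) V_U by auto
  moreover have "\<forall>l\<in>J1 - J2. C1_on (Y_space b J2) whole (pts (Y_space b J2)) (\<lambda>c. k l (Abs_ell2 c))"
    using C1_on_Y_space[OF k] by blast
  ultimately show ?thesis
    using W V_U by (intro exI[of _ "\<lambda>l c. k l (Abs_ell2 c)"]) blast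
qed

end
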